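(* Let $\mathcal A$ be a unital C$^*$-algebra generated (as a C$^*$-algebra) by self-adjoint elements $y_1,\ldots,y_p$. Let $\mathcal A_1\subseteq\mathcal A_2\subseteq\cdots$ be an increasing sequence of unital C$^*$-subalgebras of $\mathcal A$ whose union $\bigcup_j\mathcal A_j$ is norm dense in $\mathcal A$, and for each $j$ let $x_1^{(j)},\ldots,x_{n_j}^{(j)}$ be a finite family of self-adjoint elements generating $\mathcal A_j$. Then $$\mathfrak K_{top}^{(2)}(y_1,\ldots,y_p)\le\liminf_{j\to\infty}\mathfrak K_{top}^{(2)}(x_1^{(j)},\ldots,x_{n_j}^{(j)}).$$
   Context: Microstates. Let $\mathcal A$ be a unital C$^*$-algebra and $x_1,\dots,x_n$ self-adjoint elements of $\mathcal A$. Let $\{P_r\}_{r\ge1}$ enumerate all noncommutative polynomials in the indeterminates $X_1,\dots,X_n$ whose coefficients have rational real and imaginary parts (constants allowed). $\mathcal M_k^{s.a.}(\mathbb C)$ is the set of self-adjoint $k\times k$ complex matrices and $\tau_k=\frac1k\mathrm{Tr}$. For $R,\epsilon>0$ and $r,k\in\mathbb N$, $\Gamma_R^{(top)}(x_1,\dots,x_n;k,\epsilon,P_1,\dots,P_r)$ is the set of $(A_1,\dots,A_n)\in\mathcal M_k^{s.a.}(\mathbb C)^n$ with $\max_i\|A_i\|\le R$ and $\big|\|P_j(A_1,\dots,A_n)\|-\|P_j(x_1,\dots,x_n)\|\big|\le\epsilon$ for $1\le j\le r$. Covering numbers. On $\mathcal M_k(\mathbb C)^n$ put $\|(A_i)\|_2=(\sum_i\tau_k(A_i^*A_i))^{1/2}$.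 The $\omega$-orbit ball centred at $(B_i)$ is the set of $(A_i)$ such that some unitary $W\in\mathcal M_k(\mathbb C)$ satisfies $\|(A_i)-(WB_iW^* )\|_2<\omega$; for $\Sigma\subseteq\mathcal M_k(\mathbb C)^n$, $o_2(\Sigma,\omega)$ is the minimal number of $\omega$-orbit balls centred at points of $\Sigma$ covering $\Sigma$. Convention $\log 0=-\infty$. Topological orbit dimension: $\mathfrak K^{(2)}_{top}(x_1,\dots,x_n;\omega)=\sup_{R>0}\inf_{\epsilon>0,r\in\mathbb N}\limsup_{k\to\infty}\frac{\log o_2(\Gamma_R^{(top)}(x_1,\dots,x_n;k,\epsilon,P_1,\dots,P_r),\omega)}{k^2}$ and $\mathfrak K_{top}^{(2)}(x_1,\dots,x_n)=\limsup_{\omega\to0^+}\mathfrak K_{top}^{(2)}(x_1,\dots,x_n;\omega)$. *)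

theory Defs
  imports "HOL-Analysis.Analysis" "HOL-Library.Countable_Set"
begin

text \<open>The algebra is the whole type 'a, a real Banach algebra with unit (norm 1 = 1),
  equipped with a complex scalar multiplication sc extending scaleR and an involution st.\<close>

definition unital_cstar_algebra ::
  "(complex \<Rightarrow> 'a::{real_normed_algebra_1,banach} \<Rightarrow> 'a) \<Rightarrow> ('a \<Rightarrow> 'a) \<Rightarrow> bool" where
  "unital_cstar_algebra sc st \<longleftrightarrow>
     (\<forall>r x. sc (complex_of_real r) x = scaleR r x) \<and>
     (\<forall>c x y. sc c (x + y) = sc c x + sc c y) \<and>
     (\<forall>c d x. sc (c + d) x = sc c x + sc d x) \<and>
     (\<forall>c d x. sc c (sc d x) = sc (c * d) x) \<and>
     (\<forall>c x. norm (sc c x) = cmod c * norm x) \<and>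
     (\<forall>c x y. sc c (x * y) = sc c x * y) \<and>
     (\<forall>c x y. sc c (x * y) = x * sc c y) \<and>
     (\<forall>x. st (st x) = x) \<and>
     (\<forall>x y. st (x + y) = st x + st y) \<and>
     (\<forall>c x. st (sc c x) = sc (cnj c) (st x)) \<and>
     (\<forall>x y. st (x * y) = st y * st x) \<and>
     (\<forall>x. norm (st x * x) = (norm x)\<^sup>2)"

definition cstar_subalg ::
  "(complex \<Rightarrow> 'a::{real_normed_algebra_1,banach} \<Rightarrow> 'a) \<Rightarrow> ('a \<Rightarrow> 'a) \<Rightarrow> 'a set \<Rightarrow> bool" where
  "cstar_subalg sc st S \<longleftrightarrow> closed S \<and> 1 \<in> S \<and>
     (\<forall>x\<in>S. \<forall>y\<in>S. x + y \<in> S \<and> x * y \<in> S) \<and>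
     (\<forall>c. \<forall>x\<in>S. sc c x \<in> S) \<and> (\<forall>x\<in>S. st x \<in> S)"

definition cstar_gen ::
  "(complex \<Rightarrow> 'a::{real_normed_algebra_1,banach} \<Rightarrow> 'a) \<Rightarrow> ('a \<Rightarrow> 'a) \<Rightarrow> 'a set \<Rightarrow> 'a set" where
  "cstar_gen sc st G = \<Inter> {S. cstar_subalg sc st S \<and> G \<subseteq> S}"

text \<open>A noncommutative polynomial in X_0,...,X_(n-1) is a finitely supported coefficient
  function on words (lists of variable indices). The empty word is the constant monomial.\<close>
definition rat_ncpolys :: "nat \<Rightarrow> (nat list \<Rightarrow> complex) set" where
  "rat_ncpolys n = {p. finite {w. p w \<noteq> 0} \<and> (\<forall>w. p w \<noteq> 0 \<longrightarrow> set w \<subseteq> {..<n}) \<and>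
                       (\<forall>w. Re (p w) \<in> \<rat> \<and> Im (p w) \<in> \<rat>)}"

text \<open>A fixed enumeration P_1, P_2, ... (here indexed P_0, P_1, ...) of all such polynomials.\<close>
definition ncpoly_enum :: "nat \<Rightarrow> nat \<Rightarrow> (nat list \<Rightarrow> complex)" where
  "ncpoly_enum n j = from_nat_into (rat_ncpolys n) j"

definition aeval ::
  "(complex \<Rightarrow> 'a::{real_normed_algebra_1,banach} \<Rightarrow> 'a) \<Rightarrow> (nat list \<Rightarrow> complex) \<Rightarrow> (nat \<Rightarrow> 'a) \<Rightarrow> 'a" where
  "aeval sc p x = (\<Sum>w\<in>{w. p w \<noteq> 0}. sc (p w) (prod_list (map x w)))"

type_synonym cmat = "nat \<Rightarrow> nat \<Rightarrow> complex"

definition mats :: "nat \<Rightarrow> cmat set" where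
  "mats k = {A. \<forall>i j. (k \<le> i \<or> k \<le> j) \<longrightarrow> A i j = 0}"

definition mmult :: "nat \<Rightarrow> cmat \<Rightarrow> cmat \<Rightarrow> cmat" where
  "mmult k A B = (\<lambda>i j. if i < k \<and> j < k then (\<Sum>l<k. A i l * B l j) else 0)"

definition mident :: "nat \<Rightarrow> cmat" where
  "mident k = (\<lambda>i j. if i = j \<and> i < k then 1 else 0)"

definition madj :: "cmat \<Rightarrow> cmat" where
  "madj A = (\<lambda>i j. cnj (A j i))"

definition mselfadj :: "nat \<Rightarrow> cmat \<Rightarrow> bool" where
  "mselfadj k A \<longleftrightarrow> A \<in> mats k \<and> madj A = A"

definition munitary :: "nat \<Rightarrow> cmat \<Rightarrow> bool" where
  "munitary k W \<longleftrightarrow> W \<in> mats k \<and> mmult k W (madj W) = mident k"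

definition mnorm :: "nat \<Rightarrow> cmat \<Rightarrow> real" where
  "mnorm k A = Sup {sqrt (\<Sum>i<k. (cmod (\<Sum>j<k. A i j * v j))\<^sup>2) | v.
                      (\<Sum>j<k. (cmod (v j))\<^sup>2) \<le> 1}"

definition wordprod :: "nat \<Rightarrow> (nat \<Rightarrow> cmat) \<Rightarrow> nat list \<Rightarrow> cmat" where
  "wordprod k As w = foldr (\<lambda>i M. mmult k (As i) M) w (mident k)"

definition meval :: "nat \<Rightarrow> (nat list \<Rightarrow> complex) \<Rightarrow> (nat \<Rightarrow> cmat) \<Rightarrow> cmat" where
  "meval k p As = (\<lambda>a b. \<Sum>w\<in>{w. p w \<noteq> 0}. p w * wordprod k As w a b)"

definition mtuples :: "nat \<Rightarrow> nat \<Rightarrow> (nat \<Rightarrow> cmat) set" where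
  "mtuples k n = {As. (\<forall>i<n. As i \<in> mats k) \<and> (\<forall>i\<ge>n. As i = (\<lambda>_ _. 0))}"

text \<open>The 2-norm (sum_i tau_k(A_i^* A_i))^(1/2) of the difference of two tuples.\<close>
definition hs_dist :: "nat \<Rightarrow> nat \<Rightarrow> (nat \<Rightarrow> cmat) \<Rightarrow> (nat \<Rightarrow> cmat) \<Rightarrow> real" where
  "hs_dist k n As Bs =
     sqrt ((1 / real k) * (\<Sum>i<n. \<Sum>a<k. \<Sum>b<k. (cmod (As i a b - Bs i a b))\<^sup>2))"

definition orbit_ball :: "nat \<Rightarrow> nat \<Rightarrow> (nat \<Rightarrow> cmat) \<Rightarrow> real \<Rightarrow> (nat \<Rightarrow> cmat) set" where
  "orbit_ball k n Bs \<omega> = {As. \<exists>W. munitary k W \<and>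
       hs_dist k n As (\<lambda>i. mmult k (mmult k W (Bs i)) (madj W)) < \<omega>}"

definition o2 :: "nat \<Rightarrow> nat \<Rightarrow> (nat \<Rightarrow> cmat) set \<Rightarrow> real \<Rightarrow> nat" where
  "o2 k n \<Sigma> \<omega> = Inf {card C | C. finite C \<and> C \<subseteq> \<Sigma> \<and> \<Sigma> \<subseteq> (\<Union>B\<in>C. orbit_ball k n B \<omega>)}"

definition gamma_top ::
  "(complex \<Rightarrow> 'a::{real_normed_algebra_1,banach} \<Rightarrow> 'a) \<Rightarrow> nat \<Rightarrow> (nat \<Rightarrow> 'a) \<Rightarrow>
   real \<Rightarrow> nat \<Rightarrow> real \<Rightarrow> nat \<Rightarrow> (nat \<Rightarrow> cmat) set" where
  "gamma_top sc n x R k \<epsilon> r = {As \<in> mtuples k n.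
      (\<forall>i<n. mselfadj k (As i) \<and> mnorm k (As i) \<le> R) \<and>
      (\<forall>j<r. \<bar>mnorm k (meval k (ncpoly_enum n j) As) - norm (aeval sc (ncpoly_enum n j) x)\<bar> \<le> \<epsilon>)}"

definition log_ratio :: "nat \<Rightarrow> nat \<Rightarrow> ereal" where
  "log_ratio c k = (if c = 0 then -\<infinity> else ereal (ln (real c) / (real k)\<^sup>2))"

definition Ktop_omega ::
  "(complex \<Rightarrow> 'a::{real_normed_algebra_1,banach} \<Rightarrow> 'a) \<Rightarrow> nat \<Rightarrow> (nat \<Rightarrow> 'a) \<Rightarrow> real \<Rightarrow> ereal" where
  "Ktop_omega sc n x \<omega> =
     (SUP R\<in>{0<..}. INF er\<in>{0<..} \<times> {1..}.
        limsup (\<lambda>k. log_ratio (o2 k n (gamma_top sc n x R k (fst er) (snd er)) \<omega>) k))"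

definition Ktop ::
  "(complex \<Rightarrow> 'a::{real_normed_algebra_1,banach} \<Rightarrow> 'a) \<Rightarrow> nat \<Rightarrow> (nat \<Rightarrow> 'a) \<Rightarrow> ereal" where
  "Ktop sc n x = Limsup (at_right 0) (Ktop_omega sc n x)"

end

theory Submission
  imports Defs
begin

text \<open>
  Covering numbers can only grow as \<open>\<omega>\<close> decreases, so \<open>Ktop\<close> is the supremum of \<open>Ktop_omega\<close> over
  \<open>\<omega> > 0\<close>, and it suffices to bound \<open>Ktop_omega sc p y \<omega>\<close> by some \<open>Ktop_omega sc (nn j) (x j) \<omega>'\<close>
  for all large \<open>j\<close>. By density there are rational polynomials \<open>P\<^sub>i\<close> with \<open>P\<^sub>i(x\<^sup>j)\<close> close to \<open>y\<^sub>i\<close>, and,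
  since \<open>y\<close> generates, self-adjoint rational polynomials \<open>Q\<^sub>i\<close> with \<open>Q\<^sub>i(y)\<close> close to \<open>x\<^sup>j\<^sub>i\<close>. A microstate \<open>A\<close>
  of \<open>y\<close> yields the microstate \<open>Q(A)\<close> of \<open>x\<^sup>j\<close>, whose norm bound does not depend on \<open>Q\<close>, and \<open>A\<close> is
  recovered from it up to a small error as \<open>P(Q(A))\<close>. As \<open>P\<close> is Lipschitz for the normalised
  Hilbert-Schmidt norm on operator-norm balls, uniformly in the matrix size, and commutes with
  unitary conjugation, a cover by orbit balls pulls back along \<open>Q\<close>.
\<close>

section \<open>Matrices and the Hilbert-Schmidt norm\<close>

text \<open>The factor \<open>1 / sqrt k\<close> of the normalised norm is left out here and enters
  only through \<open>hs_dist\<close>. Writing the distance as an \<open>L2_set\<close> over index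
  pairs makes Minkowski's inequality available.\<close>

definition fdist :: "nat \<Rightarrow> cmat \<Rightarrow> cmat \<Rightarrow> real" where
  "fdist k A B = L2_set (\<lambda>(a, b). cmod (A a b - B a b)) ({..<k} \<times> {..<k})"

definition frob :: "nat \<Rightarrow> cmat \<Rightarrow> real" where
  "frob k A = L2_set (\<lambda>(a, b). cmod (A a b)) ({..<k} \<times> {..<k})"

text \<open>A supremum-free form of \<open>mnorm k A \<le> R\<close>, squared so that it can be
  summed over the columns of a matrix. Only the square of \<open>R\<close> occurs, so a sign
  condition on \<open>R\<close> is imposed where it matters.\<close>

definition opbound :: "nat \<Rightarrow> real \<Rightarrow> cmat \<Rightarrow> bool" where
  "opbound k R A \<longleftrightarrow> (\<forall>v. (\<Sum>i<k. (cmod (\<Sum>j<k. A i j * v j))\<^sup>2) \<le> R\<^sup>2 * (\<Sum>j<k. (cmod (v j))\<^sup>2))"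

definition mconj :: "nat \<Rightarrow> cmat \<Rightarrow> cmat \<Rightarrow> cmat" where
  "mconj k W A = mmult k (mmult k W A) (madj W)"

lemma fdist_eq_frob: "fdist k A B = frob k (\<lambda>a b. A a b - B a b)"
  by (simp add: fdist_def frob_def)

lemma frob_power2: "(frob k A)\<^sup>2 = (\<Sum>a<k. \<Sum>b<k. (cmod (A a b))\<^sup>2)"
  by (simp add: frob_def L2_set_def sum_nonneg sum.cartesian_product case_prod_beta)

lemma frob_nonneg [simp]: "0 \<le> frob k A"
  by (simp add: frob_def L2_set_nonneg)

lemma fdist_nonneg [simp]: "0 \<le> fdist k A B"
  by (simp add: fdist_def L2_set_nonneg)

lemma fdist_commute: "fdist k A B = fdist k B A"
  by (simp add: fdist_def norm_minus_commute)

lemma frob_add_le: "frob k (\<lambda>a b. A a b + B a b) \<le> frob k A + frob k B"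
proof -
  have "frob k (\<lambda>a b. A a b + B a b) \<le> L2_set (\<lambda>i. (case i of (a, b) \<Rightarrow> cmod (A a b)) + (case i of (a, b) \<Rightarrow> cmod (B a b))) ({..<k} \<times> {..<k})"
    unfolding frob_def by (rule L2_set_mono) (auto intro: norm_triangle_ineq)
  also have "\<dots> \<le> frob k A + frob k B"
    unfolding frob_def by (rule L2_set_triangle_ineq)
  finally show ?thesis .
qed

lemma fdist_triangle: "fdist k A C \<le> fdist k A B + fdist k B C"
  using frob_add_le[of k "\<lambda>a b. A a b - B a b" "\<lambda>a b. B a b - C a b"]
  by (simp add: fdist_eq_frob)

lemma frob_madj [simp]: "frob k (madj A) = frob k A"
proof -
  have "(frob k (madj A))\<^sup>2 = (frob k A)\<^sup>2"
    unfolding frob_power2 madj_def by (subst sum.swap) simp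
  then show ?thesis by simp
qed

lemma frob_scale: "frob k (\<lambda>a b. c * A a b) = cmod c * frob k A"
proof -
  have "(frob k (\<lambda>a b. c * A a b))\<^sup>2 = (cmod c * frob k A)\<^sup>2"
    by (simp add: frob_power2 norm_mult power_mult_distrib sum_distrib_left)
  then show ?thesis by (simp add: power2_eq_iff_nonneg)
qed

lemma frob_sum_le: "frob k (\<lambda>a b. \<Sum>w\<in>S. f w a b) \<le> (\<Sum>w\<in>S. frob k (f w))"
proof (induction S rule: infinite_finite_induct)
  case (insert x F)
  then show ?case using frob_add_le[of k "f x" "\<lambda>a b. \<Sum>w\<in>F. f w a b"] by simp
qed (simp_all add: frob_def L2_set_def)

section \<open>Operator norm bounds\<close>

lemma cmod_sum_mult_power2_le:
  "(cmod (\<Sum>j\<in>S. a j * b j))\<^sup>2 \<le> (\<Sum>j\<in>S. (cmod (a j))\<^sup>2) * (\<Sum>j\<in>S. (cmod (b j))\<^sup>2)"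
proof -
  have "cmod (\<Sum>j\<in>S. a j * b j) \<le> (\<Sum>j\<in>S. \<bar>cmod (a j)\<bar> * \<bar>cmod (b j)\<bar>)"
    by (rule order_trans[OF norm_sum]) (simp add: norm_mult)
  also have "\<dots> \<le> L2_set (\<lambda>j. cmod (a j)) S * L2_set (\<lambda>j. cmod (b j)) S"
    by (rule L2_set_mult_ineq)
  finally have "(cmod (\<Sum>j\<in>S. a j * b j))\<^sup>2 \<le> (L2_set (\<lambda>j. cmod (a j)) S * L2_set (\<lambda>j. cmod (b j)) S)\<^sup>2"
    by (rule power_mono) simp
  then show ?thesis by (simp add: power_mult_distrib L2_set_def sum_nonneg)
qed

text \<open>By Cauchy-Schwarz in each row the Frobenius norm is an upper bound. Without boundedness
  the real supremum defining \<open>mnorm\<close> would carry no information.\<close>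

lemma bdd_above_mnorm:
  "bdd_above {sqrt (\<Sum>i<k. (cmod (\<Sum>j<k. A i j * v j))\<^sup>2) | v. (\<Sum>j<k. (cmod (v j))\<^sup>2) \<le> 1}"
proof (rule bdd_aboveI)
  fix x assume "x \<in> {sqrt (\<Sum>i<k. (cmod (\<Sum>j<k. A i j * v j))\<^sup>2) | v. (\<Sum>j<k. (cmod (v j))\<^sup>2) \<le> 1}"
  then obtain v where v: "(\<Sum>j<k. (cmod (v j))\<^sup>2) \<le> 1"
    and x: "x = sqrt (\<Sum>i<k. (cmod (\<Sum>j<k. A i j * v j))\<^sup>2)" by blast
  have "(cmod (\<Sum>j<k. A i j * v j))\<^sup>2 \<le> (\<Sum>j<k. (cmod (A i j))\<^sup>2)" for i
  proof -
    have "(cmod (\<Sum>j<k. A i j * v j))\<^sup>2 \<le> (\<Sum>j<k. (cmod (A i j))\<^sup>2) * (\<Sum>j<k. (cmod (v j))\<^sup>2)"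
      by (rule cmod_sum_mult_power2_le)
    also have "\<dots> \<le> (\<Sum>j<k. (cmod (A i j))\<^sup>2) * 1"
      by (rule mult_left_mono[OF v]) (simp add: sum_nonneg)
    finally show ?thesis by simp
  qed
  then show "x \<le> sqrt (\<Sum>i<k. \<Sum>j<k. (cmod (A i j))\<^sup>2)"
    unfolding x by (intro real_sqrt_le_mono sum_mono)
qed

lemma mnorm_upper:
  assumes "(\<Sum>j<k. (cmod (v j))\<^sup>2) \<le> 1"
  shows "sqrt (\<Sum>i<k. (cmod (\<Sum>j<k. A i j * v j))\<^sup>2) \<le> mnorm k A"
  unfolding mnorm_def by (rule cSup_upper[OF _ bdd_above_mnorm]) (use assms in blast)

lemma mnorm_nonneg [simp]: "0 \<le> mnorm k A"
  using mnorm_upper[of "\<lambda>_. 0" k A] by simp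

text \<open>Homogeneity: a nonzero vector is rescaled to the unit ball over which the supremum
  runs.\<close>

lemma opbound_mnorm: "opbound k (mnorm k A) A"
  unfolding opbound_def
proof
  fix v :: "nat \<Rightarrow> complex"
  define s where "s = (\<Sum>j<k. (cmod (v j))\<^sup>2)"
  have s0: "s \<ge> 0" by (simp add: s_def sum_nonneg)
  show "(\<Sum>i<k. (cmod (\<Sum>j<k. A i j * v j))\<^sup>2) \<le> (mnorm k A)\<^sup>2 * (\<Sum>j<k. (cmod (v j))\<^sup>2)"
  proof (cases "s = 0")
    case True
    then have "\<forall>j<k. v j = 0" by (simp add: s_def sum_nonneg_eq_0_iff)
    then show ?thesis by simp
  next
    case False
    with s0 have s: "s > 0" by simp
    define u where "u j = v j / complex_of_real (sqrt s)" for j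
    have "(\<Sum>j<k. (cmod (u j))\<^sup>2) = (\<Sum>j<k. (cmod (v j))\<^sup>2) / s"
      using s by (simp add: u_def norm_divide power_divide sum_divide_distrib)
    then have "(\<Sum>j<k. (cmod (u j))\<^sup>2) \<le> 1" using s by (simp flip: s_def)
    from mnorm_upper[OF this, of A]
    have "(sqrt (\<Sum>i<k. (cmod (\<Sum>j<k. A i j * u j))\<^sup>2))\<^sup>2 \<le> (mnorm k A)\<^sup>2"
      by (rule power_mono) (simp add: sum_nonneg)
    then have *: "(\<Sum>i<k. (cmod (\<Sum>j<k. A i j * u j))\<^sup>2) \<le> (mnorm k A)\<^sup>2"
      by (simp add: sum_nonneg)
    have "(\<Sum>j<k. A i j * u j) = (\<Sum>j<k. A i j * v j) / complex_of_real (sqrt s)" for i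
      by (simp add: u_def sum_divide_distrib)
    then have "(cmod (\<Sum>j<k. A i j * u j))\<^sup>2 = (cmod (\<Sum>j<k. A i j * v j))\<^sup>2 / s" for i
      using s by (simp add: norm_divide power_divide)
    then have "(\<Sum>i<k. (cmod (\<Sum>j<k. A i j * u j))\<^sup>2) = (\<Sum>i<k. (cmod (\<Sum>j<k. A i j * v j))\<^sup>2) / s"
      by (simp only: sum_divide_distrib)
    with * s show ?thesis by (simp add: divide_le_eq flip: s_def)
  qed
qed

lemma opbound_mono:
  assumes "opbound k R A" "0 \<le> R" "R \<le> S"
  shows "opbound k S A"
  unfolding opbound_def
proof
  fix v
  have "R\<^sup>2 * (\<Sum>j<k. (cmod (v j))\<^sup>2) \<le> S\<^sup>2 * (\<Sum>j<k. (cmod (v j))\<^sup>2)"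
    using assms by (intro mult_right_mono power_mono sum_nonneg) auto
  with assms(1) show "(\<Sum>i<k. (cmod (\<Sum>j<k. A i j * v j))\<^sup>2) \<le> S\<^sup>2 * (\<Sum>j<k. (cmod (v j))\<^sup>2)"
    unfolding opbound_def by (meson order_trans)
qed

section \<open>Matrix algebra and norm estimates for products\<close>

lemma mmult_in_mats [simp]: "mmult k A B \<in> mats k"
  by (auto simp: mats_def mmult_def)

lemma mident_in_mats [simp]: "mident k \<in> mats k"
  by (auto simp: mats_def mident_def)

lemma madj_in_mats [simp]: "madj A \<in> mats k \<longleftrightarrow> A \<in> mats k"
  by (auto simp: mats_def madj_def)

lemma mmult_assoc: "mmult k (mmult k A B) C = mmult k A (mmult k B C)"
proof (intro ext)
  fix i j
  have "(\<Sum>l<k. (\<Sum>m<k. A i m * B m l) * C l j) = (\<Sum>m<k. A i m * (\<Sum>l<k. B m l * C l j))"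
    unfolding sum_distrib_left sum_distrib_right by (subst sum.swap) (simp add: mult.assoc)
  then show "mmult k (mmult k A B) C i j = mmult k A (mmult k B C) i j"
    by (simp add: mmult_def)
qed

lemma mmult_mident_left [simp]: "A \<in> mats k \<Longrightarrow> mmult k (mident k) A = A"
  by (intro ext) (auto simp: mmult_def mident_def mats_def if_distrib[of "\<lambda>x. x * _"] cong: if_cong)

lemma mmult_mident_right [simp]: "A \<in> mats k \<Longrightarrow> mmult k A (mident k) = A"
  by (intro ext) (auto simp: mmult_def mident_def mats_def if_distrib[of "\<lambda>x. _ * x"] cong: if_cong conj_cong)

lemma madj_madj [simp]: "madj (madj A) = A"
  by (simp add: madj_def)

lemma madj_mident [simp]: "madj (mident k) = mident k"
  by (intro ext) (auto simp: madj_def mident_def)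

lemma madj_mmult: "madj (mmult k A B) = mmult k (madj B) (madj A)"
  by (intro ext) (auto simp: madj_def mmult_def mult.commute)

lemma mmult_diff_left: "mmult k (\<lambda>a b. A a b - A' a b) B = (\<lambda>a b. mmult k A B a b - mmult k A' B a b)"
  by (intro ext) (simp add: mmult_def left_diff_distrib sum_subtractf)

lemma mmult_diff_right: "mmult k A (\<lambda>a b. B a b - B' a b) = (\<lambda>a b. mmult k A B a b - mmult k A B' a b)"
  by (intro ext) (simp add: mmult_def right_diff_distrib sum_subtractf)

lemma opbound_mmult:
  assumes A: "opbound k R A" and B: "opbound k S B"
  shows "opbound k (R * S) (mmult k A B)"
  unfolding opbound_def
proof
  fix v
  define u where "u i = (\<Sum>j<k. B i j * v j)" for i
  have "(\<Sum>j<k. mmult k A B i j * v j) = (\<Sum>j<k. A i j * u j)" if "i < k" for i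
  proof -
    have "(\<Sum>j<k. (\<Sum>l<k. A i l * B l j) * v j) = (\<Sum>l<k. A i l * (\<Sum>j<k. B l j * v j))"
      unfolding sum_distrib_left sum_distrib_right by (subst sum.swap) (simp add: mult.assoc)
    then show ?thesis using that by (simp add: mmult_def u_def)
  qed
  then have "(\<Sum>i<k. (cmod (\<Sum>j<k. mmult k A B i j * v j))\<^sup>2) = (\<Sum>i<k. (cmod (\<Sum>j<k. A i j * u j))\<^sup>2)"
    by simp
  also have "\<dots> \<le> R\<^sup>2 * (\<Sum>i<k. (cmod (u i))\<^sup>2)"
    using A by (simp add: opbound_def)
  also have "\<dots> \<le> R\<^sup>2 * (S\<^sup>2 * (\<Sum>j<k. (cmod (v j))\<^sup>2))"
    using B by (intro mult_left_mono) (simp_all add: opbound_def u_def)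
  finally show "(\<Sum>i<k. (cmod (\<Sum>j<k. mmult k A B i j * v j))\<^sup>2) \<le> (R * S)\<^sup>2 * (\<Sum>j<k. (cmod (v j))\<^sup>2)"
    by (simp add: power_mult_distrib mult.assoc)
qed

text \<open>The columns of \<open>mmult k A B\<close> are the images under \<open>A\<close> of the
  columns of \<open>B\<close>, and the operator bound applies to each.\<close>

lemma frob_mmult_le:
  assumes A: "opbound k R A" and R: "0 \<le> R"
  shows "frob k (mmult k A B) \<le> R * frob k B"
proof (rule power2_le_imp_le)
  have "(frob k (mmult k A B))\<^sup>2 = (\<Sum>b<k. \<Sum>a<k. (cmod (\<Sum>l<k. A a l * B l b))\<^sup>2)"
    unfolding frob_power2 by (subst sum.swap) (simp add: mmult_def)
  also have "\<dots> \<le> (\<Sum>b<k. R\<^sup>2 * (\<Sum>l<k. (cmod (B l b))\<^sup>2))"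
    using A by (intro sum_mono) (simp add: opbound_def)
  also have "\<dots> = (R * frob k B)\<^sup>2"
    unfolding power_mult_distrib frob_power2 by (subst sum.swap) (simp add: sum_distrib_left)
  finally show "(frob k (mmult k A B))\<^sup>2 \<le> (R * frob k B)\<^sup>2" .
qed (simp add: R)

text \<open>Taking adjoints turns right multiplication into left multiplication. The bound is put on
  \<open>madj A\<close>, so that invariance of the operator norm under adjoints is never invoked;
  the uses are self-adjoint factors and adjoints of unitaries.\<close>

lemma frob_mmult_right_le:
  assumes "opbound k R (madj A)" and "0 \<le> R"
  shows "frob k (mmult k B A) \<le> R * frob k B"
  using frob_mmult_le[OF assms, of "madj B"] frob_madj[of k "mmult k B A"]
  by (simp add: madj_mmult)

lemma frob_mident: "frob k (mident k) = sqrt (real k)"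
proof -
  have "(frob k (mident k))\<^sup>2 = (\<Sum>a<k. \<Sum>b<k. if a = b then 1 else 0)"
    unfolding frob_power2 by (intro sum.cong) (auto simp: mident_def)
  then have "(frob k (mident k))\<^sup>2 = real k" by simp
  then show ?thesis by (metis frob_nonneg real_sqrt_unique)
qed

text \<open>The product estimate is applied to \<open>A\<close> times the identity, whose Frobenius
  norm is \<open>sqrt k\<close>. After normalisation this says that the operator norm dominates the
  2-norm, uniformly in \<open>k\<close>.\<close>

lemma frob_le_mnorm:
  assumes "A \<in> mats k"
  shows "frob k A \<le> sqrt (real k) * mnorm k A"
  using frob_mmult_le[OF opbound_mnorm mnorm_nonneg, of k A "mident k"] assms
  by (simp add: frob_mident mult.commute)

lemma cmod_entry_le_frob:
  assumes "a < k" "b < k"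
  shows "cmod (A a b) \<le> frob k A"
  using member_le_L2_set[of "{..<k} \<times> {..<k}" "(a, b)" "\<lambda>(a, b). cmod (A a b)"] assms
  by (simp add: frob_def)

section \<open>Unitary matrices and conjugation by them\<close>

lemma opbound_coisometry:
  assumes W: "mmult k W (madj W) = mident k"
  shows "opbound k 1 (madj W)"
  unfolding opbound_def
proof
  fix v :: "nat \<Rightarrow> complex"
  have d: "(\<Sum>i<k. W l i * cnj (W j i)) = (if l = j then 1 else 0)" if "l < k" "j < k" for l j
    using fun_cong[OF fun_cong[OF W, of l], of j] that
    by (simp add: mmult_def madj_def mident_def)
  \<comment> \<open>Expanding the squared length and moving the sum over \<open>i\<close> inside
    leaves entries of \<open>mmult k W (madj W)\<close>, that is, of the identity.\<close>
  have "complex_of_real (\<Sum>i<k. (cmod (\<Sum>j<k. madj W i j * v j))\<^sup>2)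
      = (\<Sum>i<k. (\<Sum>j<k. cnj (W j i) * v j) * (\<Sum>l<k. W l i * cnj (v l)))"
    by (simp add: madj_def complex_norm_square del: of_real_power)
  also have "\<dots> = (\<Sum>i<k. \<Sum>j<k. \<Sum>l<k. v j * cnj (v l) * (W l i * cnj (W j i)))"
    by (simp add: sum_product ac_simps)
  also have "\<dots> = (\<Sum>j<k. \<Sum>i<k. \<Sum>l<k. v j * cnj (v l) * (W l i * cnj (W j i)))"
    by (rule sum.swap)
  also have "\<dots> = (\<Sum>j<k. \<Sum>l<k. \<Sum>i<k. v j * cnj (v l) * (W l i * cnj (W j i)))"
    by (intro sum.cong refl sum.swap)
  also have "\<dots> = (\<Sum>j<k. \<Sum>l<k. v j * cnj (v l) * (if l = j then 1 else 0))"
    by (simp add: d flip: sum_distrib_left)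
  also have "\<dots> = (\<Sum>j<k. v j * cnj (v j))"
    by (simp add: if_distrib[of "\<lambda>x. _ * x"] cong: if_cong)
  also have "\<dots> = complex_of_real (\<Sum>j<k. (cmod (v j))\<^sup>2)"
    by (simp add: complex_norm_square del: of_real_power)
  finally show "(\<Sum>i<k. (cmod (\<Sum>j<k. madj W i j * v j))\<^sup>2) \<le> 1\<^sup>2 * (\<Sum>j<k. (cmod (v j))\<^sup>2)"
    by (simp only: of_real_eq_iff power_one mult_1 order_refl)
qed

text \<open>Expanding the square gives \<open>k - 2 Re Tr(W\<^sup>*W) + \<parallel>W\<^sup>*W\<parallel>\<^sup>2\<close>, where the trace is \<open>Tr(WW\<^sup>*) = k\<close> and
  the last term is at most \<open>\<parallel>W\<parallel>\<^sup>2 = k\<close>; hence \<open>W\<^sup>*W\<close> is the identity.\<close>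
lemma munitary_left:
  assumes W: "munitary k W"
  shows "mmult k (madj W) W = mident k"
proof -
  have WW: "mmult k W (madj W) = mident k" using W by (simp add: munitary_def)
  define E where "E = mmult k (madj W) W"
  have tr: "(\<Sum>l<k. \<Sum>i<k. W l i * cnj (W l i)) = of_nat k"
  proof -
    have "(\<Sum>i<k. W l i * cnj (W l i)) = 1" if "l < k" for l
      using fun_cong[OF fun_cong[OF WW, of l], of l] that
      by (simp add: mmult_def madj_def mident_def)
    then show ?thesis by simp
  qed
  have "complex_of_real ((frob k W)\<^sup>2) = of_nat k"
    using tr by (simp add: frob_power2 complex_norm_square del: of_real_power)
  then have fW: "(frob k W)\<^sup>2 = real k"
    by (metis of_real_eq_iff of_real_of_nat_eq)
  have "frob k E \<le> 1 * frob k W"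
    unfolding E_def by (rule frob_mmult_le[OF opbound_coisometry[OF WW]]) simp
  then have fE: "(frob k E)\<^sup>2 \<le> real k"
    using fW power_mono[of "frob k E" "frob k W" 2] by simp
  have trE: "(\<Sum>a<k. E a a) = of_nat k"
  proof -
    have "(\<Sum>a<k. E a a) = (\<Sum>a<k. \<Sum>l<k. W l a * cnj (W l a))"
      by (simp add: E_def mmult_def madj_def mult.commute)
    then show ?thesis using tr by (subst (asm) sum.swap) simp
  qed
  have "(cmod (E a b - mident k a b))\<^sup>2 = (cmod (E a b))\<^sup>2 + (if a = b then 1 - 2 * Re (E a a) else 0)"
    if "a < k" "b < k" for a b
    using that unfolding mident_def cmod_power2 by (auto simp: power2_eq_square algebra_simps)
  then have "(fdist k E (mident k))\<^sup>2 = (\<Sum>a<k. \<Sum>b<k. (cmod (E a b))\<^sup>2 + (if a = b then 1 - 2 * Re (E a a) else 0))"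
    unfolding fdist_eq_frob frob_power2 by simp
  also have "\<dots> = (frob k E)\<^sup>2 + real k - 2 * Re (\<Sum>a<k. E a a)"
    by (simp add: sum.distrib sum_subtractf frob_power2 sum_distrib_left)
  also have "\<dots> \<le> 0" using fE trE by simp
  finally have "fdist k E (mident k) = 0" by simp
  then have "E a b = mident k a b" if "a < k" "b < k" for a b
    using cmod_entry_le_frob[OF that, of "\<lambda>a b. E a b - mident k a b"] by (simp add: fdist_eq_frob)
  moreover have "E a b = mident k a b" if "\<not> (a < k \<and> b < k)" for a b
    using that by (auto simp: E_def mmult_def mident_def)
  ultimately show ?thesis unfolding E_def by blast
qed

lemma munitary_madj: "munitary k W \<Longrightarrow> munitary k (madj W)"
  using munitary_left by (simp add: munitary_def)

lemma munitary_mident: "munitary k (mident k)"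
  by (simp add: munitary_def)

lemma munitary_mmult:
  assumes V: "munitary k V" and W: "munitary k W"
  shows "munitary k (mmult k V W)"
proof -
  have "mmult k (mmult k V W) (madj (mmult k V W)) = mmult k V (mmult k (mmult k W (madj W)) (madj V))"
    by (simp add: madj_mmult mmult_assoc)
  also have "\<dots> = mident k" using V W by (simp add: munitary_def)
  finally show ?thesis by (simp add: munitary_def)
qed

lemma opbound_munitary: "munitary k W \<Longrightarrow> opbound k 1 W"
  using opbound_coisometry[of k "madj W"] munitary_left[of k W] by simp

lemma mconj_in_mats [simp]: "mconj k W A \<in> mats k"
  by (simp add: mconj_def)

lemma mconj_mmult: "mconj k (mmult k V W) A = mconj k V (mconj k W A)"
  by (simp add: mconj_def mmult_assoc madj_mmult)

lemma mconj_mult: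
  assumes "munitary k W"
  shows "mconj k W (mmult k A B) = mmult k (mconj k W A) (mconj k W B)"
proof -
  have "mmult k (mconj k W A) (mconj k W B)
      = mmult k W (mmult k A (mmult k (mmult k (madj W) W) (mmult k B (madj W))))"
    by (simp add: mconj_def mmult_assoc)
  also have "\<dots> = mconj k W (mmult k A B)"
    by (simp add: munitary_left[OF assms] mconj_def mmult_assoc)
  finally show ?thesis ..
qed

lemma mconj_mident:
  assumes "munitary k W"
  shows "mconj k W (mident k) = mident k"
  using assms by (simp add: mconj_def munitary_def)

lemma mconj_by_mident: "A \<in> mats k \<Longrightarrow> mconj k (mident k) A = A"
  by (simp add: mconj_def)

lemma opbound_mconj:
  assumes "munitary k W" "opbound k R A"
  shows "opbound k R (mconj k W A)"
  using opbound_mmult[OF opbound_mmult[OF opbound_munitary[OF assms(1)] assms(2)]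
      opbound_munitary[OF munitary_madj[OF assms(1)]]]
  by (simp add: mconj_def)

lemma madj_mconj: "madj (mconj k W A) = mconj k W (madj A)"
  by (simp add: mconj_def madj_mmult mmult_assoc)

lemma fdist_mconj_le:
  assumes "munitary k W"
  shows "fdist k (mconj k W A) (mconj k W B) \<le> fdist k A B"
proof -
  let ?D = "\<lambda>a b. A a b - B a b"
  have "fdist k (mconj k W A) (mconj k W B) = frob k (mmult k (mmult k W ?D) (madj W))"
    by (simp add: fdist_eq_frob mconj_def mmult_diff_left mmult_diff_right)
  also have "\<dots> \<le> 1 * frob k (mmult k W ?D)"
    by (rule frob_mmult_right_le) (simp_all add: opbound_munitary assms)
  also have "\<dots> \<le> 1 * (1 * frob k ?D)"
    by (intro mult_left_mono frob_mmult_le) (simp_all add: opbound_munitary assms)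
  finally show ?thesis by (simp add: fdist_eq_frob)
qed

section \<open>Words and polynomials evaluated at matrix tuples\<close>

lemma wordprod_Nil [simp]: "wordprod k As [] = mident k"
  by (simp add: wordprod_def)

lemma wordprod_Cons [simp]: "wordprod k As (i # w) = mmult k (As i) (wordprod k As w)"
  by (simp add: wordprod_def)

lemma wordprod_in_mats [simp]: "wordprod k As w \<in> mats k"
  by (cases w) simp_all

lemma wordprod_append: "wordprod k As (u @ v) = mmult k (wordprod k As u) (wordprod k As v)"
  by (induction u) (simp_all add: mmult_assoc)

lemma madj_wordprod:
  assumes "\<And>i. i \<in> set w \<Longrightarrow> mselfadj k (As i)"
  shows "madj (wordprod k As w) = wordprod k As (rev w)"
  using assms
proof (induction w)
  case (Cons i w)
  then have "madj (As i) = As i" "As i \<in> mats k" by (simp_all add: mselfadj_def)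
  with Cons show ?case by (simp add: madj_mmult wordprod_append)
qed simp

lemma wordprod_mconj:
  assumes "munitary k W"
  shows "wordprod k (\<lambda>i. mconj k W (As i)) w = mconj k W (wordprod k As w)"
  by (induction w) (simp_all add: assms mconj_mident mconj_mult)

lemma meval_in_mats [simp]: "meval k p As \<in> mats k"
  using wordprod_in_mats by (fastforce simp: mats_def meval_def)

lemma mmult_sum_right: "mmult k A (\<lambda>a b. \<Sum>w\<in>S. c w * M w a b) = (\<lambda>a b. \<Sum>w\<in>S. c w * mmult k A (M w) a b)"
proof (intro ext)
  fix a b
  have "(\<Sum>l<k. \<Sum>w\<in>S. A a l * (c w * M w l b)) = (\<Sum>w\<in>S. \<Sum>l<k. c w * (A a l * M w l b))"
    by (subst sum.swap) (simp add: ac_simps)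
  then show "mmult k A (\<lambda>a b. \<Sum>w\<in>S. c w * M w a b) a b = (\<Sum>w\<in>S. c w * mmult k A (M w) a b)"
    by (cases "a < k \<and> b < k") (simp_all add: mmult_def sum_distrib_left if_not_P)
qed

lemma mmult_sum_left: "mmult k (\<lambda>a b. \<Sum>w\<in>S. c w * M w a b) A = (\<lambda>a b. \<Sum>w\<in>S. c w * mmult k (M w) A a b)"
proof (intro ext)
  fix a b
  have "(\<Sum>l<k. \<Sum>w\<in>S. c w * M w a l * A l b) = (\<Sum>w\<in>S. \<Sum>l<k. c w * (M w a l * A l b))"
    by (subst sum.swap) (simp add: ac_simps)
  then show "mmult k (\<lambda>a b. \<Sum>w\<in>S. c w * M w a b) A a b = (\<Sum>w\<in>S. c w * mmult k (M w) A a b)"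
    by (cases "a < k \<and> b < k") (simp_all add: mmult_def sum_distrib_left sum_distrib_right if_not_P)
qed

lemma meval_mconj:
  assumes "munitary k W"
  shows "meval k p (\<lambda>i. mconj k W (As i)) = mconj k W (meval k p As)"
  unfolding meval_def wordprod_mconj[OF assms] by (simp add: mconj_def mmult_sum_left mmult_sum_right)

text \<open>The letters are absorbed into \<open>D\<close> one at a time from the left, each costing
  a factor \<open>R\<close> by right multiplication; hence the induction over arbitrary
  \<open>D\<close>.\<close>

lemma frob_mmult_wordprod_le:
  assumes "\<And>i. i \<in> set w \<Longrightarrow> mselfadj k (As i) \<and> opbound k R (As i)" and "0 \<le> R"
    and "D \<in> mats k"
  shows "frob k (mmult k D (wordprod k As w)) \<le> R ^ length w * frob k D"
  using assms
proof (induction w arbitrary: D)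
  case (Cons i w)
  have "frob k (mmult k (mmult k D (As i)) (wordprod k As w)) \<le> R ^ length w * frob k (mmult k D (As i))"
    by (rule Cons.IH) (use Cons.prems in auto)
  also have "\<dots> \<le> R ^ length w * (R * frob k D)"
    by (intro mult_left_mono frob_mmult_right_le) (use Cons.prems in \<open>auto simp: mselfadj_def\<close>)
  finally show ?case by (simp add: mmult_assoc ac_simps)
qed simp

text \<open>A Lipschitz constant of a word on the ball of radius \<open>R\<close>, following the
  product rule; for nonempty \<open>w\<close> it equals
  \<open>length w * R ^ (length w - 1)\<close>.\<close>

fun word_lip :: "real \<Rightarrow> nat list \<Rightarrow> real" where
  "word_lip R [] = 0"
| "word_lip R (i # w) = R * word_lip R w + R ^ length w"

lemma word_lip_nonneg: "0 \<le> R \<Longrightarrow> 0 \<le> word_lip R w"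
  by (induction w) auto

text \<open>Telescoping AB - A'B' = A(B - B') + (A - A')B' at the first letter. The difference in
  one variable is bounded by the sum over all variables, so the same factor serves every
  word.\<close>

lemma fdist_wordprod_le:
  assumes "set w \<subseteq> {..<n}"
    and "\<And>i. i < n \<Longrightarrow> mselfadj k (As i) \<and> opbound k R (As i)"
    and "\<And>i. i < n \<Longrightarrow> mselfadj k (Bs i) \<and> opbound k R (Bs i)" and R: "0 \<le> R"
  shows "fdist k (wordprod k As w) (wordprod k Bs w) \<le> word_lip R w * (\<Sum>i<n. fdist k (As i) (Bs i))"
  using assms(1)
proof (induction w)
  case (Cons i w)
  let ?S = "\<Sum>i<n. fdist k (As i) (Bs i)"
  have i: "i < n" using Cons.prems by simp
  have "fdist k (wordprod k As (i # w)) (wordprod k Bs (i # w))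
      \<le> fdist k (mmult k (As i) (wordprod k As w)) (mmult k (As i) (wordprod k Bs w))
        + fdist k (mmult k (As i) (wordprod k Bs w)) (mmult k (Bs i) (wordprod k Bs w))"
    by (simp add: fdist_triangle)
  also have "fdist k (mmult k (As i) (wordprod k As w)) (mmult k (As i) (wordprod k Bs w))
      \<le> R * fdist k (wordprod k As w) (wordprod k Bs w)"
    unfolding fdist_eq_frob mmult_diff_right[symmetric]
    using assms(2)[OF i] R by (intro frob_mmult_le) auto
  also have "\<dots> \<le> R * (word_lip R w * ?S)"
    using Cons R by (intro mult_left_mono) auto
  also have "fdist k (mmult k (As i) (wordprod k Bs w)) (mmult k (Bs i) (wordprod k Bs w))
      \<le> R ^ length w * fdist k (As i) (Bs i)"
    unfolding fdist_eq_frob mmult_diff_left[symmetric]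
    using assms(2,3)[OF i] assms(3) R Cons.prems
    by (intro frob_mmult_wordprod_le) (auto simp: mselfadj_def mats_def)
  also have "\<dots> \<le> R ^ length w * ?S"
    using i R by (intro mult_left_mono member_le_sum) auto
  finally show ?case by (simp add: algebra_simps)
qed (simp add: fdist_def L2_set_def)

text \<open>The constant depends on the polynomial and on \<open>R\<close> but not on
  \<open>k\<close>, which makes the estimate uniform in the matrix size.\<close>

lemma fdist_meval_le:
  assumes "\<And>w. p w \<noteq> 0 \<Longrightarrow> set w \<subseteq> {..<n}"
    and "\<And>i. i < n \<Longrightarrow> mselfadj k (As i) \<and> opbound k R (As i)"
    and "\<And>i. i < n \<Longrightarrow> mselfadj k (Bs i) \<and> opbound k R (Bs i)" and "0 \<le> R"
  shows "fdist k (meval k p As) (meval k p Bs)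
    \<le> (\<Sum>w | p w \<noteq> 0. cmod (p w) * word_lip R w) * (\<Sum>i<n. fdist k (As i) (Bs i))"
proof -
  have "fdist k (meval k p As) (meval k p Bs)
      = frob k (\<lambda>a b. \<Sum>w | p w \<noteq> 0. p w * (wordprod k As w a b - wordprod k Bs w a b))"
    by (simp add: fdist_eq_frob meval_def sum_subtractf right_diff_distrib)
  also have "\<dots> \<le> (\<Sum>w | p w \<noteq> 0. cmod (p w) * fdist k (wordprod k As w) (wordprod k Bs w))"
    using frob_sum_le[of k "\<lambda>w a b. p w * (wordprod k As w a b - wordprod k Bs w a b)" "{w. p w \<noteq> 0}"]
    by (simp add: frob_scale fdist_eq_frob)
  also have "\<dots> \<le> (\<Sum>w | p w \<noteq> 0. cmod (p w) * (word_lip R w * (\<Sum>i<n. fdist k (As i) (Bs i))))"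
    using assms by (intro sum_mono mult_left_mono fdist_wordprod_le) auto
  finally show ?thesis by (simp add: sum_distrib_right mult.assoc)
qed

section \<open>Rational noncommutative polynomials\<close>

definition gauss_rat :: "complex set" where
  "gauss_rat = {c. Re c \<in> \<rat> \<and> Im c \<in> \<rat>}"

lemma gauss_rat_closed:
  "0 \<in> gauss_rat" "1 \<in> gauss_rat" "-1 \<in> gauss_rat" "1 / 2 \<in> gauss_rat"
  "c \<in> gauss_rat \<Longrightarrow> d \<in> gauss_rat \<Longrightarrow> c + d \<in> gauss_rat"
  "c \<in> gauss_rat \<Longrightarrow> d \<in> gauss_rat \<Longrightarrow> c * d \<in> gauss_rat"
  "c \<in> gauss_rat \<Longrightarrow> cnj c \<in> gauss_rat"
  by (auto simp: gauss_rat_def)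

lemma closure_gauss_rat: "closure gauss_rat = UNIV"
proof -
  have "\<exists>d\<in>gauss_rat. dist d c < e" if e: "e > 0" for c e
  proof -
    obtain u where u: "u \<in> \<rat>" "Re c < u" "u < Re c + e / 2"
      using Rats_dense_in_real[of "Re c" "Re c + e / 2"] e by auto
    obtain v where v: "v \<in> \<rat>" "Im c < v" "v < Im c + e / 2"
      using Rats_dense_in_real[of "Im c" "Im c + e / 2"] e by auto
    have "dist (Complex u v) c \<le> \<bar>Re (Complex u v - c)\<bar> + \<bar>Im (Complex u v - c)\<bar>"
      unfolding dist_norm by (rule cmod_le)
    also have "\<dots> < e" using u v by simp
    finally show ?thesis using u v by (intro bexI[of _ "Complex u v"]) (auto simp: gauss_rat_def)
  qed
  then show ?thesis by (auto simp: closure_approachable)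
qed

lemma rat_ncpolys_iff:
  "q \<in> rat_ncpolys n \<longleftrightarrow> finite {w. q w \<noteq> 0} \<and> (\<forall>w. q w \<noteq> 0 \<longrightarrow> set w \<subseteq> {..<n}) \<and> (\<forall>w. q w \<in> gauss_rat)"
  by (auto simp: rat_ncpolys_def gauss_rat_def)

text \<open>A polynomial is recovered by \<open>h\<close> from the finite set of triples of word,
  real part and imaginary part over its support, and there are countably many finite sets of such
  triples. This is what makes \<open>ncpoly_enum\<close> reach every polynomial.\<close>

lemma countable_rat_ncpolys: "countable (rat_ncpolys n)"
proof -
  define h :: "(nat list \<times> rat \<times> rat) set \<Rightarrow> nat list \<Rightarrow> complex"
    where "h F w = (\<Sum>(v, a, b)\<in>{t \<in> F. fst t = w}. Complex (of_rat a) (of_rat b))" for F w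
  have "rat_ncpolys n \<subseteq> h ` {F. finite F}"
  proof
    fix q assume q: "q \<in> rat_ncpolys n"
    then have "\<forall>w. \<exists>a b. q w = Complex (of_rat a) (of_rat b)"
      by (metis (mono_tags, lifting) Rats_cases complex.collapse mem_Collect_eq rat_ncpolys_def)
    then obtain a b where ab: "q w = Complex (of_rat (a w)) (of_rat (b w))" for w by metis
    define F where "F = (\<lambda>w. (w, a w, b w)) ` {w. q w \<noteq> 0}"
    have "{t \<in> F. fst t = w} = (if q w = 0 then {} else {(w, a w, b w)})" for w
      by (auto simp: F_def)
    then have "h F w = q w" for w using ab[of w] by (simp add: h_def)
    moreover have "finite F" using q by (simp add: F_def rat_ncpolys_def)
    ultimately show "q \<in> h ` {F. finite F}" by (metis ext image_eqI mem_Collect_eq)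
  qed
  moreover have "countable {F :: (nat list \<times> rat \<times> rat) set. finite F}"
    by (rule countable_Collect_finite)
  ultimately show ?thesis by (meson countable_image countable_subset)
qed

lemma ncpoly_enum_surj: "q \<in> rat_ncpolys n \<Longrightarrow> \<exists>j. ncpoly_enum n j = q"
  unfolding ncpoly_enum_def by (rule from_nat_into_surj[OF countable_rat_ncpolys])

lemma ncpoly_enum_in: "ncpoly_enum n j \<in> rat_ncpolys n"
proof -
  have "(\<lambda>_. 0) \<in> rat_ncpolys n" by (simp add: rat_ncpolys_def)
  then show ?thesis unfolding ncpoly_enum_def by (intro from_nat_into) auto
qed

lemma meval_superset:
  assumes "finite S" "{w. q w \<noteq> 0} \<subseteq> S"
  shows "meval k q As = (\<lambda>a b. \<Sum>w\<in>S. q w * wordprod k As w a b)"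
  unfolding meval_def using assms by (intro ext sum.mono_neutral_left) auto

lemma tendsto_in_closure:
  fixes f :: "nat \<Rightarrow> 'b::first_countable_topology"
  assumes "f \<longlonglongrightarrow> a" "\<forall>m. f m \<in> T"
  shows "a \<in> closure T"
  using assms unfolding closure_sequential by (intro exI[of _ f]) simp

section \<open>Continuity of the C*-algebra operations\<close>

locale cstar =
  fixes sc :: "complex \<Rightarrow> 'a::{real_normed_algebra_1,banach} \<Rightarrow> 'a" and st :: "'a \<Rightarrow> 'a"
  assumes cstar: "unital_cstar_algebra sc st"
begin

lemma sc_of_real: "sc (complex_of_real r) x = scaleR r x"
  and sc_add_right: "sc c (x + y) = sc c x + sc c y"
  and sc_add_left: "sc (c + d) x = sc c x + sc d x"
  and sc_sc: "sc c (sc d x) = sc (c * d) x"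
  and norm_sc: "norm (sc c x) = cmod c * norm x"
  and mult_sc_left: "sc c x * y = sc c (x * y)"
  and mult_sc_right: "x * sc c y = sc c (x * y)"
  and st_st: "st (st x) = x"
  and st_add: "st (x + y) = st x + st y"
  and st_sc: "st (sc c x) = sc (cnj c) (st x)"
  and st_mult: "st (x * y) = st y * st x"
  and cstar_identity: "norm (st x * x) = (norm x)\<^sup>2"
  using cstar unfolding unital_cstar_algebra_def by metis+

lemma bounded_bilinear_sc: "bounded_bilinear sc"
proof
  show "sc (r *\<^sub>R c) x = r *\<^sub>R sc c x" for r c x
    by (metis sc_of_real sc_sc scaleR_conv_of_real)
  show "sc c (r *\<^sub>R x) = r *\<^sub>R sc c x" for r c x
    by (simp add: sc_of_real[symmetric] sc_sc mult.commute)
  show "\<exists>K. \<forall>c x. norm (sc c x) \<le> norm c * norm x * K"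
    by (rule exI[of _ 1]) (simp add: norm_sc)
qed (simp_all add: sc_add_left sc_add_right)

lemma sc_zero [simp]: "sc 0 x = 0" "sc c 0 = 0"
  by (simp_all add: bounded_bilinear.zero_left[OF bounded_bilinear_sc] bounded_bilinear.zero_right[OF bounded_bilinear_sc])

lemma sc_one [simp]: "sc 1 x = x"
  using sc_of_real[of 1 x] by simp

lemma sc_neg_one [simp]: "sc (- 1) x = - x"
  using sc_of_real[of "-1" x] by simp

text \<open>The C*-identity bounds the square of \<open>norm x\<close> by
  \<open>norm (st x) * norm x\<close>, and \<open>norm x\<close> cancels. Applied to
  \<open>st x\<close> this makes \<open>st\<close> continuous.\<close>

lemma norm_st_le: "norm x \<le> norm (st x)"
proof (cases "norm x = 0")
  case False
  have "norm x * norm x \<le> norm (st x) * norm x"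
    using norm_mult_ineq[of "st x" x] cstar_identity[of x] by (simp add: power2_eq_square)
  with False show ?thesis by simp
qed simp

lemma bounded_linear_st: "bounded_linear st"
proof
  show "st (r *\<^sub>R x) = r *\<^sub>R st x" for r x
    by (metis complex_cnj_complex_of_real sc_of_real st_sc)
  show "\<exists>K. \<forall>x. norm (st x) \<le> norm x * K"
    by (rule exI[of _ 1]) (use norm_st_le[of "st _"] in \<open>simp add: st_st\<close>)
qed (simp add: st_add)

lemma st_one [simp]: "st 1 = 1"
  by (metis mult_1 mult.right_neutral st_mult st_st)

section \<open>Simultaneous polynomial values in the algebra and on matrices\<close>

lemma aeval_superset:
  assumes "finite S" "{w. q w \<noteq> 0} \<subseteq> S"
  shows "aeval sc q x = (\<Sum>w\<in>S. sc (q w) (prod_list (map x w)))"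
  unfolding aeval_def using assms by (intro sum.mono_neutral_left) auto

text \<open>The pairs of a matrix function and an algebra element that are the values of a common
  rational noncommutative polynomial, on self-adjoint matrix tuples and at \<open>y\<close> respectively.\<close>
definition poly_rep :: "nat \<Rightarrow> (nat \<Rightarrow> 'a) \<Rightarrow> (nat \<Rightarrow> (nat \<Rightarrow> cmat) \<Rightarrow> cmat) \<Rightarrow> 'a \<Rightarrow> bool" where
  "poly_rep n y F a \<longleftrightarrow> (\<exists>q\<in>rat_ncpolys n. aeval sc q y = a \<and>
     (\<forall>k As. (\<forall>i<n. mselfadj k (As i)) \<longrightarrow> meval k q As = F k As))"

lemma poly_rep_add:
  assumes "poly_rep n y F a" "poly_rep n y G b"
  shows "poly_rep n y (\<lambda>k As i j. F k As i j + G k As i j) (a + b)"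
proof -
  obtain p q where p: "p \<in> rat_ncpolys n" "aeval sc p y = a"
      "\<And>k As. \<forall>i<n. mselfadj k (As i) \<Longrightarrow> meval k p As = F k As"
    and q: "q \<in> rat_ncpolys n" "aeval sc q y = b"
      "\<And>k As. \<forall>i<n. mselfadj k (As i) \<Longrightarrow> meval k q As = G k As"
    using assms unfolding poly_rep_def by blast
  define r where "r w = p w + q w" for w
  \<comment> \<open>Cancellation may shrink the support of the sum, so all three evaluations are
    taken over the union of the two supports.\<close>
  let ?S = "{w. p w \<noteq> 0} \<union> {w. q w \<noteq> 0}"
  have fin: "finite ?S" using p(1) q(1) by (simp add: rat_ncpolys_iff)
  have sub: "{w. r w \<noteq> 0} \<subseteq> ?S" by (auto simp: r_def)
  have "r \<in> rat_ncpolys n"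
    using p(1) q(1) finite_subset[OF sub fin] unfolding rat_ncpolys_iff
    by (auto simp: r_def gauss_rat_closed) (metis add.right_neutral add_0 lessThan_iff subset_iff)+
  moreover have "aeval sc r y = aeval sc p y + aeval sc q y"
    unfolding aeval_superset[OF fin sub] aeval_superset[OF fin Un_upper1] aeval_superset[OF fin Un_upper2]
    by (simp add: r_def sc_add_left sum.distrib)
  moreover have "meval k r As = (\<lambda>i j. meval k p As i j + meval k q As i j)" for k As
    unfolding meval_superset[OF fin sub] meval_superset[OF fin Un_upper1] meval_superset[OF fin Un_upper2]
    by (simp add: r_def sum.distrib distrib_right)
  ultimately show ?thesis
    unfolding poly_rep_def by (intro bexI[of _ r]) (simp_all add: p q)
qed

lemma poly_rep_monom:
  assumes "c \<in> gauss_rat" "set u \<subseteq> {..<n}"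
  shows "poly_rep n y (\<lambda>k As i j. c * wordprod k As u i j) (sc c (prod_list (map y u)))"
proof -
  define q where "q w = (if w = u then c else 0)" for w
  have sub: "{w. q w \<noteq> 0} \<subseteq> {u}" by (auto simp: q_def)
  have "q \<in> rat_ncpolys n"
    using assms finite_subset[OF sub] by (auto simp: rat_ncpolys_iff q_def gauss_rat_closed)
  moreover have "aeval sc q y = sc c (prod_list (map y u))"
    by (subst aeval_superset[OF _ sub]) (simp_all add: q_def)
  moreover have "meval k q As = (\<lambda>i j. c * wordprod k As u i j)" for k As
    by (subst meval_superset[OF _ sub]) (simp_all add: q_def)
  ultimately show ?thesis unfolding poly_rep_def by blast
qed

lemma poly_rep_zero: "poly_rep n y (\<lambda>k As i j. 0) 0"
  using poly_rep_monom[of 0 "[]" n y] by (simp add: gauss_rat_closed)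

lemma poly_rep_sum:
  assumes "\<And>w. w \<in> S \<Longrightarrow> poly_rep n y (F w) (a w)"
  shows "poly_rep n y (\<lambda>k As i j. \<Sum>w\<in>S. F w k As i j) (\<Sum>w\<in>S. a w)"
  using assms
proof (induction S rule: infinite_finite_induct)
  case (insert w S)
  then show ?case using poly_rep_add[of n y "F w" "a w"] by simp
qed (simp_all add: poly_rep_zero)

lemma poly_rep_cong:
  assumes "poly_rep n y F a" "\<And>k As. \<forall>i<n. mselfadj k (As i) \<Longrightarrow> F k As = G k As"
  shows "poly_rep n y G a"
proof -
  obtain q where q: "q \<in> rat_ncpolys n" "aeval sc q y = a"
      "\<And>k As. \<forall>i<n. mselfadj k (As i) \<Longrightarrow> meval k q As = F k As"
    using assms(1) unfolding poly_rep_def by blast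
  then show ?thesis
    unfolding poly_rep_def using assms(2) by (intro bexI[of _ q]) simp_all
qed

text \<open>Expanding the product gives a double sum of monomials in concatenated words. Closure of
  \<open>poly_rep\<close> under sums spares collecting the coefficients of coinciding
  concatenations.\<close>

lemma poly_rep_mult:
  assumes "poly_rep n y F a" "poly_rep n y G b"
  shows "poly_rep n y (\<lambda>k As. mmult k (F k As) (G k As)) (a * b)"
proof -
  obtain p q where p: "p \<in> rat_ncpolys n" "aeval sc p y = a"
      "\<And>k As. \<forall>i<n. mselfadj k (As i) \<Longrightarrow> meval k p As = F k As"
    and q: "q \<in> rat_ncpolys n" "aeval sc q y = b"
      "\<And>k As. \<forall>i<n. mselfadj k (As i) \<Longrightarrow> meval k q As = G k As"
    using assms unfolding poly_rep_def by blast
  have "poly_rep n y (\<lambda>k As i j. \<Sum>u | p u \<noteq> 0. \<Sum>v | q v \<noteq> 0. (p u * q v) * wordprod k As (u @ v) i j)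
          (\<Sum>u | p u \<noteq> 0. \<Sum>v | q v \<noteq> 0. sc (p u * q v) (prod_list (map y (u @ v))))"
    using p(1) q(1) by (intro poly_rep_sum poly_rep_monom) (auto simp: rat_ncpolys_iff gauss_rat_closed)
  moreover have "(\<Sum>u | p u \<noteq> 0. \<Sum>v | q v \<noteq> 0. sc (p u * q v) (prod_list (map y (u @ v)))) = a * b"
    unfolding p(2)[symmetric] q(2)[symmetric]
    by (simp add: aeval_def sum_product mult_sc_left mult_sc_right sc_sc mult.commute)
  moreover have "mmult k (meval k p As) (meval k q As)
     = (\<lambda>i j. \<Sum>u | p u \<noteq> 0. \<Sum>v | q v \<noteq> 0. (p u * q v) * wordprod k As (u @ v) i j)" for k As
    by (simp add: meval_def mmult_sum_left mmult_sum_right wordprod_append sum_distrib_left mult.assoc)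
  ultimately have "poly_rep n y (\<lambda>k As. mmult k (meval k p As) (meval k q As)) (a * b)"
    by simp
  then show ?thesis by (rule poly_rep_cong) (simp add: p(3) q(3))
qed

lemma poly_rep_in_mats: "poly_rep n y F a \<Longrightarrow> \<forall>i<n. mselfadj k (As i) \<Longrightarrow> F k As \<in> mats k"
  unfolding poly_rep_def by (metis meval_in_mats)

text \<open>Scaling is multiplication by a constant polynomial; the identity matrix it introduces
  drops out because \<open>F k As\<close> lies in \<open>mats k\<close>.\<close>

lemma poly_rep_scale:
  assumes "poly_rep n y F a" "c \<in> gauss_rat"
  shows "poly_rep n y (\<lambda>k As i j. c * F k As i j) (sc c a)"
proof -
  have "poly_rep n y (\<lambda>k As. mmult k (\<lambda>i j. c * wordprod k As [] i j) (F k As)) (sc c (prod_list (map y [])) * a)"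
    by (intro poly_rep_mult poly_rep_monom assms) simp
  then have "poly_rep n y (\<lambda>k As. mmult k (\<lambda>i j. c * wordprod k As [] i j) (F k As)) (sc c a)"
    by (simp add: mult_sc_left)
  moreover have "mmult k (\<lambda>i j. c * wordprod k As [] i j) (F k As) = (\<lambda>i j. c * F k As i j)"
    if "\<forall>i<n. mselfadj k (As i)" for k As
  proof -
    have "mmult k (\<lambda>i j. c * mident k i j) (F k As) = (\<lambda>i j. c * mmult k (mident k) (F k As) i j)"
      using mmult_sum_left[of k "\<lambda>_. c" "\<lambda>_. mident k" "{()}"] by simp
    then show ?thesis using poly_rep_in_mats[OF assms(1) that] by simp
  qed
  ultimately show ?thesis by (rule poly_rep_cong)
qed

text \<open>The word \<open>[i]\<close> evaluates to \<open>As i\<close> times the identity, which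
  returns \<open>As i\<close> because self-adjointness includes membership in
  \<open>mats k\<close>.\<close>

lemma poly_rep_var:
  assumes "i < n"
  shows "poly_rep n y (\<lambda>k As. As i) (y i)"
proof (rule poly_rep_cong)
  show "poly_rep n y (\<lambda>k As i' j. 1 * wordprod k As [i] i' j) (y i)"
    using poly_rep_monom[of 1 "[i]" n y] assms by (simp add: gauss_rat_closed)
qed (use assms in \<open>simp add: mselfadj_def\<close>)

lemma poly_rep_diff:
  assumes "poly_rep n y F a" "poly_rep n y G b"
  shows "poly_rep n y (\<lambda>k As i j. F k As i j - G k As i j) (a - b)"
  using poly_rep_add[OF assms(1) poly_rep_scale[OF assms(2) gauss_rat_closed(3)]] by simp

text \<open>The adjoint polynomial has conjugated coefficients and reversed words. Self-adjointness
  of the variables enters twice: for \<open>y\<close> in the algebra and for \<open>As\<close> among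
  the matrices.\<close>

lemma poly_rep_adj:
  assumes "poly_rep n y F a" and y: "\<And>i. i < n \<Longrightarrow> st (y i) = y i"
  shows "poly_rep n y (\<lambda>k As. madj (F k As)) (st a)"
proof -
  obtain p where p: "p \<in> rat_ncpolys n" "aeval sc p y = a"
      "\<And>k As. \<forall>i<n. mselfadj k (As i) \<Longrightarrow> meval k p As = F k As"
    using assms unfolding poly_rep_def by blast
  have w: "set w \<subseteq> {..<n}" if "p w \<noteq> 0" for w using p(1) that by (simp add: rat_ncpolys_iff)
  have "poly_rep n y (\<lambda>k As i j. \<Sum>u | p u \<noteq> 0. cnj (p u) * wordprod k As (rev u) i j)
          (\<Sum>u | p u \<noteq> 0. sc (cnj (p u)) (prod_list (map y (rev u))))"
    using p(1) by (intro poly_rep_sum poly_rep_monom) (auto simp: rat_ncpolys_iff gauss_rat_closed)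
  also have "(\<Sum>u | p u \<noteq> 0. sc (cnj (p u)) (prod_list (map y (rev u)))) = st a"
  proof -
    have "st (prod_list (map y u)) = prod_list (map y (rev u))" if "set u \<subseteq> {..<n}" for u
      using that by (induction u) (auto simp: st_mult y)
    then show ?thesis
      unfolding p(2)[symmetric] aeval_def linear_sum[OF bounded_linear.linear[OF bounded_linear_st]]
      by (intro sum.cong) (auto simp: st_sc w)
  qed
  finally show ?thesis
  proof (rule poly_rep_cong)
    fix k As
    assume As: "\<forall>i<n. mselfadj k (As i)"
    have "wordprod k As (rev u) i j = cnj (wordprod k As u j i)" if "p u \<noteq> 0" for u i j
    proof -
      have "wordprod k As (rev u) = madj (wordprod k As u)"
        by (rule madj_wordprod[symmetric]) (use w[OF that] As in auto)
      then show ?thesis by (simp add: madj_def)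
    qed
    then show "(\<lambda>i j. \<Sum>u | p u \<noteq> 0. cnj (p u) * wordprod k As (rev u) i j) = madj (F k As)"
      unfolding p(3)[OF As, symmetric] by (simp add: meval_def madj_def)
  qed
qed

text \<open>Words are handled by induction, then combined linearly. The purpose is that a polynomial
  in polynomials of a microstate is again a polynomial in that microstate, so that the microstate
  condition controls its norm.\<close>

lemma poly_rep_compose:
  assumes P: "P \<in> rat_ncpolys m" and G: "\<And>i. i < m \<Longrightarrow> poly_rep n y (G i) (b i)"
  shows "poly_rep n y (\<lambda>k As. meval k P (\<lambda>i. G i k As)) (aeval sc P b)"
proof -
  have "poly_rep n y (\<lambda>k As. wordprod k (\<lambda>i. G i k As) w) (prod_list (map b w))"
    if "set w \<subseteq> {..<m}" for w
    using that
  proof (induction w)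
    case Nil
    show ?case using poly_rep_monom[of 1 "[]" n y] by (simp add: gauss_rat_closed)
  next
    case (Cons i w)
    then show ?case by (simp add: poly_rep_mult G)
  qed
  then show ?thesis
    unfolding meval_def aeval_def using P
    by (intro poly_rep_sum poly_rep_scale) (auto simp: rat_ncpolys_iff)
qed

lemma poly_rep_enum:
  assumes "poly_rep n y F a"
  shows "\<exists>j. aeval sc (ncpoly_enum n j) y = a \<and>
    (\<forall>k As. (\<forall>i<n. mselfadj k (As i)) \<longrightarrow> meval k (ncpoly_enum n j) As = F k As)"
proof -
  obtain q where q: "q \<in> rat_ncpolys n" "aeval sc q y = a"
      "\<forall>k As. (\<forall>i<n. mselfadj k (As i)) \<longrightarrow> meval k q As = F k As"
    using assms unfolding poly_rep_def by blast
  obtain j where "ncpoly_enum n j = q" using ncpoly_enum_surj[OF q(1)] by blast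
  with q show ?thesis by (intro exI[of _ j]) simp
qed

section \<open>Density of polynomial values in the generated algebra\<close>

lemma cstar_gen_subset_closure:
  assumes y: "\<And>i. i < n \<Longrightarrow> st (y i) = y i"
  shows "cstar_gen sc st (y ` {..<n}) \<subseteq> closure {a. \<exists>F. poly_rep n y F a}"
proof -
  \<comment> \<open>The closure of the set of rational polynomial values is shown to be a
    C*-subalgebra containing the generators, so it contains the intersection
    \<open>cstar_gen\<close>.\<close>
  let ?T = "{a. \<exists>F. poly_rep n y F a}"
  have 1: "1 \<in> ?T" using poly_rep_monom[of 1 "[]" n y] by (auto simp: gauss_rat_closed)
  have alg: "a + b \<in> closure ?T" "a * b \<in> closure ?T" if ab: "a \<in> closure ?T" "b \<in> closure ?T" for a b
  proof -
    obtain f g where f: "\<And>m. f m \<in> ?T" "f \<longlonglongrightarrow> a" and g: "\<And>m. g m \<in> ?T" "g \<longlonglongrightarrow> b"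
      using ab unfolding closure_sequential by blast
    have "\<forall>m. f m + g m \<in> ?T" "\<forall>m. f m * g m \<in> ?T"
      using f(1) g(1) poly_rep_add poly_rep_mult by blast+
    with tendsto_add[OF f(2) g(2)] tendsto_mult[OF f(2) g(2)]
    show "a + b \<in> closure ?T" "a * b \<in> closure ?T"
      by (simp_all add: tendsto_in_closure)
  qed
  have scal: "sc c a \<in> closure ?T" if a: "a \<in> closure ?T" for c a
  proof -
    obtain f where f: "\<And>m. f m \<in> ?T" "f \<longlonglongrightarrow> a"
      using a unfolding closure_sequential by blast
    \<comment> \<open>\<open>?T\<close> is closed only under scalars with rational real and
      imaginary parts; a general \<open>c\<close> is reached by approximating scalar and element
      together.\<close>
    have "c \<in> closure gauss_rat" by (simp add: closure_gauss_rat)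
    then obtain d where d: "\<And>m. d m \<in> gauss_rat" "d \<longlonglongrightarrow> c"
      unfolding closure_sequential by blast
    have "\<forall>m. sc (d m) (f m) \<in> ?T"
      using f(1) d(1) poly_rep_scale by blast
    with bounded_bilinear.tendsto[OF bounded_bilinear_sc d(2) f(2)] show ?thesis
      by (simp add: tendsto_in_closure)
  qed
  have adj: "st a \<in> closure ?T" if a: "a \<in> closure ?T" for a
  proof -
    obtain f where f: "\<And>m. f m \<in> ?T" "f \<longlonglongrightarrow> a"
      using a unfolding closure_sequential by blast
    have "\<forall>m. st (f m) \<in> ?T"
      using f(1) poly_rep_adj[of n y, OF _ y] by blast
    with bounded_linear.tendsto[OF bounded_linear_st f(2)] show ?thesis
      by (simp add: tendsto_in_closure)
  qed
  have "y ` {..<n} \<subseteq> closure ?T"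
    using poly_rep_var closure_subset[of ?T] by blast
  moreover have "cstar_subalg sc st (closure ?T)"
    unfolding cstar_subalg_def using alg scal adj 1 closure_subset[of ?T] by auto
  ultimately show ?thesis unfolding cstar_gen_def by blast
qed

text \<open>Each approximant is averaged with its adjoint, which preserves convergence since
  \<open>b\<close> is self-adjoint. Averaging the matrix functions alongside makes their values
  exactly self-adjoint, as membership in a microstate space demands.\<close>

lemma poly_rep_selfadj_approx:
  assumes y: "\<And>i. i < n \<Longrightarrow> st (y i) = y i"
    and b: "b \<in> closure {a. \<exists>F. poly_rep n y F a}" "st b = b"
  shows "\<exists>f F. (\<forall>m. poly_rep n y (F m) (f m) \<and>
      (\<forall>k As. (\<forall>i<n. mselfadj k (As i)) \<longrightarrow> mselfadj k (F m k As))) \<and> f \<longlonglongrightarrow> b"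
proof -
  obtain f where f: "\<And>m. \<exists>F. poly_rep n y F (f m)" "f \<longlonglongrightarrow> b"
    using b(1) unfolding closure_sequential by blast
  then obtain F where F: "\<And>m. poly_rep n y (F m) (f m)" by metis
  define g where "g m = sc (1 / 2) (f m + st (f m))" for m
  define G where "G m k As i j = (1 / 2) * (F m k As i j + madj (F m k As) i j)" for m k As i j
  have rep: "poly_rep n y (G m) (g m)" for m
    unfolding g_def G_def
    by (intro poly_rep_scale poly_rep_add poly_rep_adj F y gauss_rat_closed)
  have "madj (G m k As) = G m k As" for m k As
    by (intro ext) (simp add: madj_def G_def add.commute)
  then have "mselfadj k (G m k As)" if "\<forall>i<n. mselfadj k (As i)" for m k As
    using poly_rep_in_mats[OF rep that] by (simp add: mselfadj_def)
  moreover have "g \<longlonglongrightarrow> sc (1 / 2) (b + st b)"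
    unfolding g_def
    by (intro bounded_bilinear.tendsto[OF bounded_bilinear_sc] tendsto_add tendsto_const f(2)
        bounded_linear.tendsto[OF bounded_linear_st])
  moreover have "sc (1 / 2) (b + st b) = sc (1 / 2 + 1 / 2) b"
    unfolding b(2) sc_add_right sc_add_left ..
  ultimately show ?thesis using rep by (intro exI[of _ g] exI[of _ G]) simp
qed

lemma tendsto_aeval:
  assumes q: "q \<in> rat_ncpolys n" and f: "\<And>i. i < n \<Longrightarrow> ((\<lambda>m. f m i) \<longlongrightarrow> x i) net"
  shows "((\<lambda>m. aeval sc q (f m)) \<longlongrightarrow> aeval sc q x) net"
proof -
  have "((\<lambda>m. prod_list (map (f m) w)) \<longlongrightarrow> prod_list (map x w)) net" if "set w \<subseteq> {..<n}" for w
    using that by (induction w) (auto intro!: tendsto_mult f)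
  then show ?thesis
    unfolding aeval_def using q
    by (intro tendsto_sum bounded_bilinear.tendsto[OF bounded_bilinear_sc] tendsto_const)
       (auto simp: rat_ncpolys_iff)
qed

end

section \<open>Orbit covering numbers\<close>

lemma hs_dist_eq: "hs_dist k n As Bs = L2_set (\<lambda>i. fdist k (As i) (Bs i)) {..<n} / sqrt (real k)"
  by (simp add: hs_dist_def L2_set_def fdist_eq_frob frob_power2 real_sqrt_divide)

lemma hs_dist_commute: "hs_dist k n As Bs = hs_dist k n Bs As"
  by (simp add: hs_dist_eq fdist_commute)

lemma hs_dist_triangle: "hs_dist k n As Cs \<le> hs_dist k n As Bs + hs_dist k n Bs Cs"
proof -
  have "L2_set (\<lambda>i. fdist k (As i) (Cs i)) {..<n}
      \<le> L2_set (\<lambda>i. fdist k (As i) (Bs i) + fdist k (Bs i) (Cs i)) {..<n}"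
    by (rule L2_set_mono) (simp_all add: fdist_triangle)
  also have "\<dots> \<le> L2_set (\<lambda>i. fdist k (As i) (Bs i)) {..<n} + L2_set (\<lambda>i. fdist k (Bs i) (Cs i)) {..<n}"
    by (rule L2_set_triangle_ineq)
  finally show ?thesis
    by (simp add: hs_dist_eq divide_right_mono flip: add_divide_distrib)
qed

lemma hs_dist_mconj_le:
  assumes "munitary k W"
  shows "hs_dist k n (\<lambda>i. mconj k W (As i)) (\<lambda>i. mconj k W (Bs i)) \<le> hs_dist k n As Bs"
  unfolding hs_dist_eq
  by (intro divide_right_mono L2_set_mono fdist_mconj_le assms) simp_all

lemma hs_dist_le_sum: "hs_dist k n As Bs \<le> (\<Sum>i<n. fdist k (As i) (Bs i)) / sqrt (real k)"
  unfolding hs_dist_eq by (intro divide_right_mono L2_set_le_sum) simp_all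

lemma fdist_le_hs_dist:
  assumes "i < n" "k > 0"
  shows "fdist k (As i) (Bs i) \<le> sqrt (real k) * hs_dist k n As Bs"
  using member_le_L2_set[of "{..<n}" i "\<lambda>i. fdist k (As i) (Bs i)"] assms
  by (simp add: hs_dist_eq)

lemma orbit_ball_iff:
  "As \<in> orbit_ball k n Bs \<omega> \<longleftrightarrow> (\<exists>W. munitary k W \<and> hs_dist k n As (\<lambda>i. mconj k W (Bs i)) < \<omega>)"
  by (simp add: orbit_ball_def mconj_def)

text \<open>If \<open>V\<close> and \<open>V'\<close> bring the centre close to \<open>Bs\<close>
  and \<open>Bs'\<close>, conjugation by \<open>mmult k V (madj V')\<close> carries the second
  translate of the centre to the first without increasing distances, so the two errors add.\<close>

lemma orbit_ball_common_center:
  assumes B: "Bs \<in> orbit_ball k n Cs \<omega>" and B': "Bs' \<in> orbit_ball k n Cs \<omega>"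
    and Cs: "\<And>i. i < n \<Longrightarrow> Cs i \<in> mats k"
  shows "\<exists>W. munitary k W \<and> hs_dist k n Bs (\<lambda>i. mconj k W (Bs' i)) < 2 * \<omega>"
proof -
  obtain V where V: "munitary k V" "hs_dist k n Bs (\<lambda>i. mconj k V (Cs i)) < \<omega>"
    using B unfolding orbit_ball_iff by blast
  obtain V' where V': "munitary k V'" "hs_dist k n Bs' (\<lambda>i. mconj k V' (Cs i)) < \<omega>"
    using B' unfolding orbit_ball_iff by blast
  define W where "W = mmult k V (madj V')"
  have W: "munitary k W"
    unfolding W_def by (intro munitary_mmult munitary_madj V V')
  have "mmult k W V' = V"
    using V(1) V'(1) by (simp add: W_def mmult_assoc munitary_left) (simp add: munitary_def)
  then have "mconj k W (mconj k V' (Cs i)) = mconj k V (Cs i)" for i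
    by (simp flip: mconj_mmult)
  then have "hs_dist k n (\<lambda>i. mconj k V (Cs i)) (\<lambda>i. mconj k W (Bs' i)) \<le> hs_dist k n (\<lambda>i. mconj k V' (Cs i)) Bs'"
    using hs_dist_mconj_le[OF W, of n "\<lambda>i. mconj k V' (Cs i)" Bs'] by simp
  then have "hs_dist k n Bs (\<lambda>i. mconj k W (Bs' i)) < 2 * \<omega>"
    using V(2) V'(2) hs_dist_triangle[of k n Bs "\<lambda>i. mconj k W (Bs' i)" "\<lambda>i. mconj k V (Cs i)"]
    by (simp add: hs_dist_commute[of k n Bs'])
  with W show ?thesis by blast
qed

section \<open>Finite covers and minimal covering numbers\<close>

definition orbit_cover :: "nat \<Rightarrow> nat \<Rightarrow> (nat \<Rightarrow> cmat) set \<Rightarrow> real \<Rightarrow> (nat \<Rightarrow> cmat) set \<Rightarrow> bool" where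
  "orbit_cover k n \<Sigma> \<omega> C \<longleftrightarrow> finite C \<and> C \<subseteq> \<Sigma> \<and> \<Sigma> \<subseteq> (\<Union>B\<in>C. orbit_ball k n B \<omega>)"

lemma o2_le_card: "orbit_cover k n \<Sigma> \<omega> C \<Longrightarrow> o2 k n \<Sigma> \<omega> \<le> card C"
  unfolding o2_def orbit_cover_def by (rule cInf_lower) auto

text \<open>The infimum of an empty set of naturals is 0, so attainment presupposes some finite
  cover; hence the cover hypotheses here and below.\<close>

lemma o2_attained:
  assumes "orbit_cover k n \<Sigma> \<omega> C"
  obtains C' where "orbit_cover k n \<Sigma> \<omega> C'" "card C' = o2 k n \<Sigma> \<omega>"
proof -
  have "o2 k n \<Sigma> \<omega> \<in> {card C | C. finite C \<and> C \<subseteq> \<Sigma> \<and> \<Sigma> \<subseteq> (\<Union>B\<in>C. orbit_ball k n B \<omega>)}"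
    unfolding o2_def by (rule Inf_nat_def1) (use assms in \<open>auto simp: orbit_cover_def\<close>)
  then show ?thesis using that by (auto simp: orbit_cover_def)
qed

lemma o2_antimono:
  assumes "orbit_cover k n \<Sigma> \<omega> C" "\<omega> \<le> \<omega>'"
  shows "o2 k n \<Sigma> \<omega>' \<le> o2 k n \<Sigma> \<omega>"
proof -
  obtain C' where C': "orbit_cover k n \<Sigma> \<omega> C'" "card C' = o2 k n \<Sigma> \<omega>"
    using o2_attained[OF assms(1)] .
  have "orbit_ball k n B \<omega> \<subseteq> orbit_ball k n B \<omega>'" for B
    using assms(2) by (force simp: orbit_ball_iff)
  then have "orbit_cover k n \<Sigma> \<omega>' C'"
    using C'(1) unfolding orbit_cover_def by blast
  then show ?thesis using o2_le_card C'(2) by metis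
qed

text \<open>Centres of the covering balls must lie in the covered set, so a ball of the cover of \<open>T\<close> is
  replaced by one around a point of \<open>S\<close> that \<open>q\<close> maps into it.\<close>
lemma o2_le_of_map:
  assumes cov: "orbit_cover k m T \<omega>' C" and q: "q ` S \<subseteq> T"
    and ball: "\<And>A A' B. A \<in> S \<Longrightarrow> A' \<in> S \<Longrightarrow> B \<in> T \<Longrightarrow> q A \<in> orbit_ball k m B \<omega>' \<Longrightarrow>
      q A' \<in> orbit_ball k m B \<omega>' \<Longrightarrow> A \<in> orbit_ball k n A' \<omega>"
  shows "o2 k n S \<omega> \<le> o2 k m T \<omega>'"
proof -
  obtain C where C: "orbit_cover k m T \<omega>' C" and card: "card C = o2 k m T \<omega>'"
    using o2_attained[OF cov] .
  define D where "D = {B \<in> C. \<exists>A\<in>S. q A \<in> orbit_ball k m B \<omega>'}"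
  have "\<forall>B\<in>D. \<exists>A. A \<in> S \<and> q A \<in> orbit_ball k m B \<omega>'"
    by (auto simp: D_def)
  from bchoice[OF this] obtain g where g: "\<And>B. B \<in> D \<Longrightarrow> g B \<in> S \<and> q (g B) \<in> orbit_ball k m B \<omega>'"
    by blast
  have fin: "finite C" and CT: "C \<subseteq> T" and TC: "T \<subseteq> (\<Union>B\<in>C. orbit_ball k m B \<omega>')"
    using C by (simp_all add: orbit_cover_def)
  have "S \<subseteq> (\<Union>B\<in>g ` D. orbit_ball k n B \<omega>)"
  proof
    fix A assume A: "A \<in> S"
    then have "q A \<in> T" using q by blast
    then obtain B where B: "B \<in> C" "q A \<in> orbit_ball k m B \<omega>'" using TC by blast
    then have "B \<in> D" using A by (auto simp: D_def)
    moreover have "A \<in> orbit_ball k n (g B) \<omega>"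
      by (rule ball[of A "g B" B]) (use A B g[OF \<open>B \<in> D\<close>] CT in auto)
    ultimately show "A \<in> (\<Union>B\<in>g ` D. orbit_ball k n B \<omega>)" by blast
  qed
  moreover have finD: "finite D" "card D \<le> card C" using fin by (auto simp: D_def intro: card_mono)
  ultimately have "orbit_cover k n S \<omega> (g ` D)"
    using g by (auto simp: orbit_cover_def)
  then have "o2 k n S \<omega> \<le> card (g ` D)" by (rule o2_le_card)
  also have "\<dots> \<le> card D" using finD by (intro card_image_le)
  also have "\<dots> \<le> o2 k m T \<omega>'" using finD card by simp
  finally show ?thesis .
qed

text \<open>Entries are rounded to a finite net, which leaves finitely many rounded tuples. Tuples
  with equal rounding are close, and one member of \<open>S\<close> is chosen for each rounding so
  that the centres lie in \<open>S\<close>.\<close>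

lemma orbit_cover_exists:
  assumes S: "S \<subseteq> mtuples k n"
    and bd: "\<And>As i a b. As \<in> S \<Longrightarrow> i < n \<Longrightarrow> a < k \<Longrightarrow> b < k \<Longrightarrow> cmod (As i a b) \<le> R"
    and \<omega>: "\<omega> > 0"
  shows "\<exists>C. orbit_cover k n S \<omega> C"
proof -
  \<comment> \<open>Entries with equal rounding differ by less than \<open>2 * \<delta>\<close>, so
    the squared distance is at most \<open>n * k\<close> times the square of
    \<open>2 * \<delta>\<close>. As \<open>n * k\<close> is less than the square of
    \<open>M\<close>, this stays below the square of \<open>\<omega>\<close>.\<close>
  define M where "M = real (n * k) + 1"
  have M: "M \<ge> 1" by (simp add: M_def)
  define \<delta> where "\<delta> = \<omega> / (2 * M)"
  have \<delta>: "\<delta> > 0" using \<omega> M by (simp add: \<delta>_def)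
  obtain N where N: "finite N" "cball (0 :: complex) R \<subseteq> (\<Union>z\<in>N. ball z \<delta>)"
    using compact_eq_totally_bounded[of "cball (0 :: complex) R"] \<delta> by auto
  then have "\<forall>z\<in>cball 0 R. \<exists>y\<in>N. dist y z < \<delta>" by (auto simp: subset_iff)
  then obtain f where f: "\<And>z. cmod z \<le> R \<Longrightarrow> f z \<in> N \<and> dist (f z) z < \<delta>"
    by (metis dist_0_norm mem_cball)
  define I where "I = {..<n} \<times> {..<k} \<times> {..<k}"
  define K where "K As = restrict (\<lambda>(i, a, b). f (As i a b)) I" for As :: "nat \<Rightarrow> cmat"
  have fN: "f (As i a b) \<in> N" "dist (f (As i a b)) (As i a b) < \<delta>"
    if "As \<in> S" "i < n" "a < k" "b < k" for As i a b
    using f[OF bd[OF that]] by simp_all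
  have "K ` S \<subseteq> I \<rightarrow>\<^sub>E N"
  proof (intro image_subsetI PiE_I)
    fix As t assume "As \<in> S" "t \<in> I"
    then show "K As t \<in> N"
      using fN(1)[of As "fst t" "fst (snd t)" "snd (snd t)"]
      by (simp add: K_def I_def case_prod_beta mem_Times_iff)
  qed (simp add: K_def)
  moreover have "finite (I \<rightarrow>\<^sub>E N)" using N(1) by (intro finite_PiE) (auto simp: I_def)
  ultimately have fin: "finite (K ` S)" by (rule finite_subset)
  have "As \<in> orbit_ball k n (inv_into S K (K As)) \<omega>" if As: "As \<in> S" for As
  proof -
    define Bs where "Bs = inv_into S K (K As)"
    have Bs: "Bs \<in> S" "K Bs = K As"
      using As unfolding Bs_def by (simp_all add: inv_into_into f_inv_into_f)
    have d: "(cmod (As i a b - Bs i a b))\<^sup>2 \<le> (2 * \<delta>)\<^sup>2" if "i < n" "a < k" "b < k" for i a b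
    proof -
      have "f (Bs i a b) = f (As i a b)"
        using fun_cong[OF Bs(2), of "(i, a, b)"] that by (simp add: K_def I_def)
      moreover have "dist (f (As i a b)) (As i a b) < \<delta>" "dist (f (Bs i a b)) (Bs i a b) < \<delta>"
        using fN(2)[OF As that] fN(2)[OF Bs(1) that] .
      ultimately have "dist (As i a b) (Bs i a b) < 2 * \<delta>"
        using dist_triangle2[of "As i a b" "Bs i a b" "f (As i a b)"] by (simp add: dist_commute)
      then show ?thesis by (intro power_mono) (simp_all add: dist_norm)
    qed
    have "(1 / real k) * (\<Sum>i<n. \<Sum>a<k. \<Sum>b<k. (cmod (As i a b - Bs i a b))\<^sup>2)
        \<le> (1 / real k) * (\<Sum>i<n. \<Sum>a<k. \<Sum>b<k. (2 * \<delta>)\<^sup>2)"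
      by (intro mult_left_mono sum_mono d) auto
    also have "\<dots> \<le> real (n * k) * (2 * \<delta>)\<^sup>2"
      by (cases "k = 0") simp_all
    also have "\<dots> < M\<^sup>2 * (2 * \<delta>)\<^sup>2"
    proof (intro mult_strict_right_mono)
      show "real (n * k) < M\<^sup>2"
        using M mult_left_mono[of 1 M M] by (simp add: power2_eq_square M_def)
    qed (use \<delta> in simp)
    also have "\<dots> = \<omega>\<^sup>2"
      unfolding \<delta>_def power_mult_distrib[symmetric] using M by simp
    finally have "hs_dist k n As Bs < \<omega>"
      unfolding hs_dist_def using \<omega> by (intro real_less_lsqrt) simp_all
    moreover have "hs_dist k n As (\<lambda>i. mconj k (mident k) (Bs i)) = hs_dist k n As Bs"
    proof -
      have "mconj k (mident k) (Bs i) = Bs i" if "i < n" for i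
        using Bs(1) S that by (intro mconj_by_mident) (auto simp: mtuples_def)
      then show ?thesis by (simp add: hs_dist_def)
    qed
    ultimately show ?thesis
      unfolding orbit_ball_iff Bs_def using munitary_mident by metis
  qed
  then have "orbit_cover k n S \<omega> (inv_into S K ` K ` S)"
    using fin by (auto simp: orbit_cover_def intro: inv_into_into)
  then show ?thesis ..
qed

section \<open>Covering numbers of microstate spaces and the scale\<close>

lemma gamma_top_orbit_cover:
  assumes "\<omega> > 0"
  shows "\<exists>C. orbit_cover k n (gamma_top sc n x R k \<epsilon> r) \<omega> C"
proof (rule orbit_cover_exists)
  fix As i a b
  assume "As \<in> gamma_top sc n x R k \<epsilon> r" and ik: "i < n" "a < k" "b < k"
  then have m: "As i \<in> mats k" "mnorm k (As i) \<le> R"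
    by (auto simp: gamma_top_def mselfadj_def)
  \<comment> \<open>This bound grows with \<open>k\<close>, which is harmless: only finiteness of a
    cover for each fixed \<open>k\<close> is at stake.\<close>
  have "cmod (As i a b) \<le> sqrt (real k) * mnorm k (As i)"
    using cmod_entry_le_frob[OF ik(2,3)] frob_le_mnorm[OF m(1)] by (rule order_trans)
  also have "\<dots> \<le> sqrt (real k) * R" using m(2) by (intro mult_left_mono) auto
  finally show "cmod (As i a b) \<le> sqrt (real k) * R" .
qed (use assms in \<open>auto simp: gamma_top_def\<close>)

lemma log_ratio_mono: "c \<le> d \<Longrightarrow> log_ratio c k \<le> log_ratio d k"
  by (auto simp: log_ratio_def intro: divide_right_mono)

lemma Ktop_omega_antimono:
  assumes "0 < \<omega>" "\<omega> \<le> \<omega>'"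
  shows "Ktop_omega sc n x \<omega>' \<le> Ktop_omega sc n x \<omega>"
  unfolding Ktop_omega_def
proof (intro SUP_mono' INF_mono' Limsup_mono always_eventually allI log_ratio_mono)
  fix R er k
  obtain C where "orbit_cover k n (gamma_top sc n x R k (fst er) (snd er)) \<omega> C"
    using gamma_top_orbit_cover[OF assms(1)] by blast
  then show "o2 k n (gamma_top sc n x R k (fst er) (snd er)) \<omega>'
      \<le> o2 k n (gamma_top sc n x R k (fst er) (snd er)) \<omega>"
    using assms(2) by (rule o2_antimono)
qed

text \<open>Every smaller scale gives at least the value at \<open>\<omega>\<close>, and these
  scales fill a right neighbourhood of 0.\<close>

lemma Ktop_omega_le_Ktop:
  assumes "0 < \<omega>"
  shows "Ktop_omega sc n x \<omega> \<le> Ktop sc n x"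
  unfolding Ktop_def
proof (rule le_Limsup)
  show "eventually (\<lambda>\<omega>'. Ktop_omega sc n x \<omega> \<le> Ktop_omega sc n x \<omega>') (at_right 0)"
    using eventually_at_right_real[OF assms]
    by (rule eventually_mono) (simp add: Ktop_omega_antimono)
qed simp

section \<open>Comparing microstates of two families\<close>

context cstar
begin

text \<open>Each of the finitely many polynomials has an index in the enumeration, and
  \<open>r\<close> exceeds all of these. The statement for all \<open>r' \<ge> r\<close> lets
  several thresholds be merged by adding them.\<close>

lemma gamma_top_poly_rep:
  assumes "finite T" "\<And>t. t \<in> T \<Longrightarrow> poly_rep n y (H t) (a t)"
  obtains r where "\<forall>r'\<ge>r. \<forall>R k \<epsilon>. \<forall>As\<in>gamma_top sc n y R k \<epsilon> r'. \<forall>t\<in>T.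
    \<bar>mnorm k (H t k As) - norm (a t)\<bar> \<le> \<epsilon>"
proof -
  have "\<forall>t\<in>T. \<exists>j. aeval sc (ncpoly_enum n j) y = a t \<and>
    (\<forall>k As. (\<forall>i<n. mselfadj k (As i)) \<longrightarrow> meval k (ncpoly_enum n j) As = H t k As)"
    using poly_rep_enum[OF assms(2)] by blast
  from bchoice[OF this] obtain J where J: "\<And>t. t \<in> T \<Longrightarrow> aeval sc (ncpoly_enum n (J t)) y = a t"
    "\<And>t k As. t \<in> T \<Longrightarrow> \<forall>i<n. mselfadj k (As i) \<Longrightarrow> meval k (ncpoly_enum n (J t)) As = H t k As"
    by blast
  obtain r where r: "\<And>t. t \<in> T \<Longrightarrow> J t < r"
    using finite_imageI[OF assms(1), of J] by (auto simp: finite_nat_set_iff_bounded)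
  have "\<bar>mnorm k (H t k As) - norm (a t)\<bar> \<le> \<epsilon>"
    if "r \<le> r'" and As: "As \<in> gamma_top sc n y R k \<epsilon> r'" and t: "t \<in> T" for r' R k \<epsilon> As t
  proof -
    have "J t < r'" using r[OF t] that(1) by simp
    then have "\<bar>mnorm k (meval k (ncpoly_enum n (J t)) As) - norm (aeval sc (ncpoly_enum n (J t)) y)\<bar> \<le> \<epsilon>"
      and sa: "\<forall>i<n. mselfadj k (As i)"
      using As by (auto simp: gamma_top_def)
    then show ?thesis by (simp add: J(1)[OF t] J(2)[OF t sa])
  qed
  then show ?thesis by (intro that) blast
qed

text \<open>Finitely many convergence requirements hold at one common index. The tolerance 1 on the
  generators does not depend on \<open>\<eta>\<close>, so the norm bound on \<open>b\<close> stays
  fixed as the accuracy of the polynomial values improves.\<close>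

lemma selfadj_approx_eventually:
  assumes y: "\<And>i. i < p \<Longrightarrow> st (y i) = y i"
    and x: "\<And>i. i < n \<Longrightarrow> st (x i) = x i"
    and gen: "\<And>i. i < n \<Longrightarrow> x i \<in> closure {a. \<exists>F. poly_rep p y F a}"
    and T: "finite T" "T \<subseteq> rat_ncpolys n" and \<eta>: "\<eta> > 0"
  obtains G b where "\<forall>i<n. poly_rep p y (G i) (b i)" and "\<forall>i<n. norm (b i - x i) < 1"
    and "\<forall>i<n. \<forall>k As. (\<forall>i<p. mselfadj k (As i)) \<longrightarrow> mselfadj k (G i k As)"
    and "\<forall>q\<in>T. norm (aeval sc q b - aeval sc q x) < \<eta>"
proof -
  have "\<forall>i. \<exists>f F. i < n \<longrightarrow> (\<forall>m. poly_rep p y (F m) (f m) \<and>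
      (\<forall>k As. (\<forall>i<p. mselfadj k (As i)) \<longrightarrow> mselfadj k (F m k As))) \<and> f \<longlonglongrightarrow> x i"
  proof
    fix i
    show "\<exists>f F. i < n \<longrightarrow> (\<forall>m. poly_rep p y (F m) (f m) \<and>
      (\<forall>k As. (\<forall>i<p. mselfadj k (As i)) \<longrightarrow> mselfadj k (F m k As))) \<and> f \<longlonglongrightarrow> x i"
      using poly_rep_selfadj_approx[of p y, OF y gen x, of i] by (cases "i < n") simp_all
  qed
  from choice[OF this] obtain f where "\<forall>i. \<exists>F. i < n \<longrightarrow> (\<forall>m. poly_rep p y (F m) (f i m) \<and>
      (\<forall>k As. (\<forall>i<p. mselfadj k (As i)) \<longrightarrow> mselfadj k (F m k As))) \<and> f i \<longlonglongrightarrow> x i" by blast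
  from choice[OF this] obtain F where F: "\<And>i. i < n \<Longrightarrow> (\<forall>m. poly_rep p y (F i m) (f i m) \<and>
      (\<forall>k As. (\<forall>i<p. mselfadj k (As i)) \<longrightarrow> mselfadj k (F i m k As))) \<and> f i \<longlonglongrightarrow> x i" by blast
  have "\<forall>q\<in>T. eventually (\<lambda>m. norm (aeval sc q (\<lambda>i. f i m) - aeval sc q x) < \<eta>) sequentially"
  proof
    fix q assume "q \<in> T"
    then have "(\<lambda>m. aeval sc q (\<lambda>i. f i m)) \<longlonglongrightarrow> aeval sc q x"
      using T F by (intro tendsto_aeval[of q n]) auto
    from tendstoD[OF this \<eta>]
    show "eventually (\<lambda>m. norm (aeval sc q (\<lambda>i. f i m) - aeval sc q x) < \<eta>) sequentially"
      by (simp add: dist_norm)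
  qed
  then have 1: "eventually (\<lambda>m. \<forall>q\<in>T. norm (aeval sc q (\<lambda>i. f i m) - aeval sc q x) < \<eta>) sequentially"
    using T(1) by (simp add: eventually_ball_finite)
  have "\<forall>i\<in>{..<n}. eventually (\<lambda>m. norm (f i m - x i) < 1) sequentially"
  proof
    fix i assume "i \<in> {..<n}"
    then have "f i \<longlonglongrightarrow> x i" using F by simp
    from tendstoD[OF this zero_less_one] show "eventually (\<lambda>m. norm (f i m - x i) < 1) sequentially"
      by (simp add: dist_norm)
  qed
  then have 2: "eventually (\<lambda>m. \<forall>i\<in>{..<n}. norm (f i m - x i) < 1) sequentially"
    by (simp add: eventually_ball_finite)
  obtain m where m: "\<forall>q\<in>T. norm (aeval sc q (\<lambda>i. f i m) - aeval sc q x) < \<eta>"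
      "\<forall>i\<in>{..<n}. norm (f i m - x i) < 1"
    using eventually_happens'[OF sequentially_bot eventually_conj[OF 1 2]] by blast
  show ?thesis
    by (rule that[of "\<lambda>i. F i m" "\<lambda>i. f i m"]) (simp_all add: m F)
qed

text \<open>The order of choices matters: \<open>R'\<close>, \<open>L\<close> and
  \<open>\<omega>'\<close> are fixed without reference to \<open>R\<close>,
  \<open>\<epsilon>'\<close> or \<open>r'\<close>, while \<open>\<epsilon>\<close> and
  \<open>r\<close> are found afterwards and serve all \<open>k\<close>. This allows the infima over
  tolerances to be compared at fixed radius and scale.\<close>

lemma o2_gamma_top_le:
  fixes x y :: "nat \<Rightarrow> 'a"
  assumes y: "\<And>i. i < p \<Longrightarrow> st (y i) = y i"
    and x: "\<And>i. i < n \<Longrightarrow> st (x i) = x i"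
    and gen: "\<And>i. i < n \<Longrightarrow> x i \<in> closure {a. \<exists>F. poly_rep p y F a}"
    and P: "\<And>i. i < p \<Longrightarrow> P i \<in> rat_ncpolys n"
      "\<And>i. i < p \<Longrightarrow> norm (aeval sc (P i) x - y i) < \<delta>"
    and \<delta>: "0 < \<delta>" "8 * (real p + 1) * \<delta> \<le> \<omega>"
    and R': "R' = (\<Sum>i<n. norm (x i)) + 2"
    and L: "L = (\<Sum>i<p. \<Sum>w | P i w \<noteq> 0. cmod (P i w) * word_lip R' w)"
    and \<omega>': "\<omega>' = \<omega> / (8 * ((real p + 1) * (real n + 1) * (L + 1)))"
    and \<epsilon>': "0 < \<epsilon>'"
  shows "\<exists>\<epsilon>>0. \<exists>r\<ge>1. \<forall>k. o2 k p (gamma_top sc p y R k \<epsilon> r) \<omega> \<le> o2 k n (gamma_top sc n x R' k \<epsilon>' r') \<omega>'"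
proof -
  have R0: "R' \<ge> 0" unfolding R' by (simp add: sum_nonneg)
  have Li: "0 \<le> (\<Sum>w | P i w \<noteq> 0. cmod (P i w) * word_lip R' w)" for i
    by (intro sum_nonneg mult_nonneg_nonneg word_lip_nonneg R0) simp
  have L0: "L \<ge> 0" unfolding L by (intro sum_nonneg Li)
  have "8 * (real p + 1) * \<delta> > 0" using \<delta>(1) by (intro mult_pos_pos) auto
  then have \<omega>: "\<omega> > 0" using \<delta>(2) by linarith
  have \<omega>'0: "\<omega>' > 0" unfolding \<omega>' using \<omega> L0 by (intro divide_pos_pos mult_pos_pos) auto
  \<comment> \<open>The bound \<open>\<epsilon>' / 2\<close> leaves room for the microstate error
    and the passage from \<open>b\<close> to \<open>x\<close>. The bound 1 keeps the norms of
    \<open>q k As i\<close> at most \<open>norm (x i) + 2\<close>. The bound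
    \<open>\<delta> / 2\<close> is spent twice on top of \<open>\<delta>\<close>, giving
    \<open>2 * \<delta>\<close> in \<open>close\<close>.\<close>
  define \<epsilon> where "\<epsilon> = min (\<epsilon>' / 2) (min 1 (\<delta> / 2))"
  have \<epsilon>: "\<epsilon> > 0" "\<epsilon> \<le> \<epsilon>' / 2" "\<epsilon> \<le> 1" "\<epsilon> \<le> \<delta> / 2" using \<epsilon>' \<delta> by (auto simp: \<epsilon>_def)
  \<comment> \<open>Accuracy is required for the polynomials tested in the target microstate space
    and for the \<open>P i\<close> that recover \<open>y\<close>.\<close>
  define T where "T = ncpoly_enum n ` {..<r'} \<union> P ` {..<p}"
  have T: "finite T" "T \<subseteq> rat_ncpolys n"
    using P(1) by (auto simp: T_def ncpoly_enum_in)
  obtain G0 b where G0: "\<forall>i<n. poly_rep p y (G0 i) (b i)" "\<forall>i<n. norm (b i - x i) < 1"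
      "\<forall>i<n. \<forall>k As. (\<forall>i<p. mselfadj k (As i)) \<longrightarrow> mselfadj k (G0 i k As)"
    and bT: "\<forall>q\<in>T. norm (aeval sc q b - aeval sc q x) < \<epsilon>"
    using selfadj_approx_eventually[of p y n x, OF y x gen T \<epsilon>(1)] .
  have b: "\<And>l. l < r' \<Longrightarrow> norm (aeval sc (ncpoly_enum n l) b - aeval sc (ncpoly_enum n l) x) < \<epsilon>"
      "\<And>i. i < p \<Longrightarrow> norm (aeval sc (P i) b - aeval sc (P i) x) < \<epsilon>"
    using bT by (simp_all add: T_def)
  \<comment> \<open>Members of \<open>mtuples k n\<close> vanish from index \<open>n\<close> on, so
    the tuple is extended by zero.\<close>
  define G where "G i = (if i < n then G0 i else (\<lambda>_ _ _ _. 0))" for i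
  define q where "q k As = (\<lambda>i. G i k As)" for k As
  have G: "poly_rep p y (G i) (b i)" if "i < n" for i
    using G0(1) that by (simp add: G_def)
  have "poly_rep p y (\<lambda>k As. meval k (ncpoly_enum n l) (\<lambda>i. G i k As)) (aeval sc (ncpoly_enum n l) b)"
    if "l \<in> {..<r'}" for l
    by (rule poly_rep_compose[OF ncpoly_enum_in[of n]]) (rule G)
  from gamma_top_poly_rep[OF finite_lessThan this]
  obtain r1 where r1: "\<forall>r\<ge>r1. \<forall>R k \<epsilon>. \<forall>As\<in>gamma_top sc p y R k \<epsilon> r. \<forall>l\<in>{..<r'}.
      \<bar>mnorm k (meval k (ncpoly_enum n l) (\<lambda>i. G i k As)) - norm (aeval sc (ncpoly_enum n l) b)\<bar> \<le> \<epsilon>" .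
  have "poly_rep p y (G i) (b i)" if "i \<in> {..<n}" for i using G that by simp
  from gamma_top_poly_rep[OF finite_lessThan this]
  obtain r2 where r2: "\<forall>r\<ge>r2. \<forall>R k \<epsilon>. \<forall>As\<in>gamma_top sc p y R k \<epsilon> r. \<forall>i\<in>{..<n}.
      \<bar>mnorm k (G i k As) - norm (b i)\<bar> \<le> \<epsilon>" .
  have "poly_rep p y (\<lambda>k As a c. As i a c - meval k (P i) (\<lambda>i. G i k As) a c) (y i - aeval sc (P i) b)"
    if "i \<in> {..<p}" for i
    using that by (intro poly_rep_diff poly_rep_var poly_rep_compose[OF P(1)] G) auto
  from gamma_top_poly_rep[OF finite_lessThan this]
  obtain r3 where r3: "\<forall>r\<ge>r3. \<forall>R k \<epsilon>. \<forall>As\<in>gamma_top sc p y R k \<epsilon> r. \<forall>i\<in>{..<p}.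
      \<bar>mnorm k (\<lambda>a c. As i a c - meval k (P i) (\<lambda>i. G i k As) a c) - norm (y i - aeval sc (P i) b)\<bar> \<le> \<epsilon>" .
  \<comment> \<open>The sum dominates all three thresholds; the summand 1 puts \<open>r\<close> into
    the index range \<open>{1..}\<close> of the infimum.\<close>
  define r where "r = r1 + r2 + r3 + 1"
  have "o2 k p (gamma_top sc p y R k \<epsilon> r) \<omega> \<le> o2 k n (gamma_top sc n x R' k \<epsilon>' r') \<omega>'" for k
  proof -
    let ?S = "gamma_top sc p y R k \<epsilon> r" and ?T = "gamma_top sc n x R' k \<epsilon>' r'"
    have sa: "\<forall>i<p. mselfadj k (As i)" if "As \<in> ?S" for As
      using that by (auto simp: gamma_top_def)
    have qsa: "mselfadj k (q k As i)" if "As \<in> ?S" "i < n" for As i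
      using G0(3) sa[OF that(1)] that(2) by (simp add: q_def G_def)
    have qn: "mnorm k (q k As i) \<le> R'" if "As \<in> ?S" "i < n" for As i
    proof -
      have "\<bar>mnorm k (q k As i) - norm (b i)\<bar> \<le> \<epsilon>"
        using r2[rule_format, of r As R k \<epsilon> i] that by (simp add: r_def q_def)
      moreover have "norm (b i) \<le> norm (x i) + 1"
        using G0(2)[rule_format, OF that(2)] norm_triangle_ineq2[of "b i" "x i"] by linarith
      moreover have "norm (x i) \<le> (\<Sum>i<n. norm (x i))"
        using that(2) by (intro member_le_sum) auto
      ultimately show ?thesis using \<epsilon>(3) unfolding R' by linarith
    qed
    have qT: "q k As \<in> ?T" if As: "As \<in> ?S" for As
    proof -
      have "\<bar>mnorm k (meval k (ncpoly_enum n l) (q k As)) - norm (aeval sc (ncpoly_enum n l) x)\<bar> \<le> \<epsilon>'"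
        if "l < r'" for l
      proof -
        have "\<bar>mnorm k (meval k (ncpoly_enum n l) (q k As)) - norm (aeval sc (ncpoly_enum n l) b)\<bar> \<le> \<epsilon>"
          using r1[rule_format, of r As R k \<epsilon> l] As that by (simp add: r_def q_def)
        moreover have "\<bar>norm (aeval sc (ncpoly_enum n l) b) - norm (aeval sc (ncpoly_enum n l) x)\<bar> \<le> \<epsilon>"
          using b(1)[OF that] norm_triangle_ineq3[of "aeval sc (ncpoly_enum n l) b" "aeval sc (ncpoly_enum n l) x"]
          by linarith
        ultimately show ?thesis using \<epsilon>(2) by linarith
      qed
      moreover have "q k As \<in> mtuples k n"
        using qsa[OF As] by (auto simp: mtuples_def mselfadj_def q_def G_def)
      ultimately show ?thesis
        using qsa[OF As] qn[OF As] by (simp add: gamma_top_def)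
    qed
    \<comment> \<open>The recovery error is itself a polynomial in \<open>As\<close>, so the
      microstate condition bounds its operator norm, and this in turn bounds the Frobenius
      norm.\<close>
    have close: "fdist k (As i) (meval k (P i) (q k As)) \<le> sqrt (real k) * (2 * \<delta>)"
      if As: "As \<in> ?S" and i: "i < p" for As i
    proof -
      let ?D = "\<lambda>a c. As i a c - meval k (P i) (q k As) a c"
      have "\<bar>mnorm k ?D - norm (y i - aeval sc (P i) b)\<bar> \<le> \<epsilon>"
        using r3[rule_format, of r As R k \<epsilon> i] As i by (simp add: r_def q_def)
      moreover have "norm (y i - aeval sc (P i) b) \<le> norm (aeval sc (P i) x - y i) + norm (aeval sc (P i) b - aeval sc (P i) x)"
        using norm_triangle_ineq4[of "y i - aeval sc (P i) x" "aeval sc (P i) b - aeval sc (P i) x"]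
        by (simp add: norm_minus_commute)
      ultimately have D: "mnorm k ?D \<le> 2 * \<delta>"
        using b(2)[OF i] P(2)[OF i] \<epsilon>(4) by linarith
      have "As i \<in> mats k" using sa[OF As] i by (simp add: mselfadj_def)
      then have "?D \<in> mats k"
        using meval_in_mats[of k "P i" "q k As"] by (simp add: mats_def)
      then have "fdist k (As i) (meval k (P i) (q k As)) \<le> sqrt (real k) * mnorm k ?D"
        unfolding fdist_eq_frob by (rule frob_le_mnorm)
      also have "\<dots> \<le> sqrt (real k) * (2 * \<delta>)"
        using D by (intro mult_left_mono) auto
      finally show ?thesis .
    qed
    have ball: "As \<in> orbit_ball k p As' \<omega>"
      if As: "As \<in> ?S" and As': "As' \<in> ?S" and Bs: "Bs \<in> ?T"
        and qB: "q k As \<in> orbit_ball k n Bs \<omega>'" "q k As' \<in> orbit_ball k n Bs \<omega>'" for As As' Bs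
    proof -
      have "\<And>i. i < n \<Longrightarrow> Bs i \<in> mats k"
        using Bs by (auto simp: gamma_top_def mselfadj_def)
      from orbit_ball_common_center[OF qB this]
      obtain W where W: "munitary k W" "hs_dist k n (q k As) (\<lambda>i. mconj k W (q k As' i)) < 2 * \<omega>'"
        by blast
      have "hs_dist k p As (\<lambda>i. mconj k W (As' i)) < \<omega>"
      proof (cases "k = 0")
        \<comment> \<open>For \<open>k = 0\<close> the factor \<open>1 / real k\<close> is 0 by
          convention, so the distance vanishes.\<close>
        case True
        then show ?thesis using \<omega> by (simp add: hs_dist_def)
      next
        case False
        then have k: "k > 0" by simp
        let ?Q = "\<lambda>i. mconj k W (q k As' i)"
        have opb: "opbound k R' (q k As i)" "opbound k R' (?Q i)"
          "mselfadj k (q k As i)" "mselfadj k (?Q i)" if "i < n" for i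
        proof -
          show "opbound k R' (q k As i)"
            by (rule opbound_mono[OF opbound_mnorm mnorm_nonneg qn[OF As that]])
          show "opbound k R' (?Q i)"
            by (intro opbound_mconj W(1) opbound_mono[OF opbound_mnorm mnorm_nonneg qn[OF As' that]])
          show "mselfadj k (q k As i)" by (rule qsa[OF As that])
          show "mselfadj k (?Q i)"
            using qsa[OF As' that] by (simp add: mselfadj_def madj_mconj)
        qed
        have "(\<Sum>i<n. fdist k (q k As i) (?Q i)) \<le> (\<Sum>i<n. sqrt (real k) * (2 * \<omega>'))"
        proof (intro sum_mono)
          fix i assume "i \<in> {..<n}"
          then have "fdist k (q k As i) (?Q i) \<le> sqrt (real k) * hs_dist k n (q k As) ?Q"
            using k by (intro fdist_le_hs_dist) auto
          also have "\<dots> \<le> sqrt (real k) * (2 * \<omega>')"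
            using W(2) by (intro mult_left_mono) auto
          finally show "fdist k (q k As i) (?Q i) \<le> sqrt (real k) * (2 * \<omega>')" .
        qed
        then have S: "(\<Sum>i<n. fdist k (q k As i) (?Q i)) \<le> real n * (sqrt (real k) * (2 * \<omega>'))"
          by simp
        have one: "fdist k (As i) (mconj k W (As' i)) \<le> sqrt (real k) * (4 * \<delta> + L * (real n * (2 * \<omega>')))"
          if i: "i < p" for i
        proof -
          let ?M = "meval k (P i)"
          \<comment> \<open>The path goes from \<open>As i\<close> to its recovery from
            \<open>q k As\<close>, by the Lipschitz bound to the recovery from \<open>?Q\<close>,
            and by equivariance of evaluation under \<open>W\<close> to the conjugate of
            \<open>As' i\<close>.\<close>
          have "fdist k (As i) (mconj k W (As' i))
              \<le> fdist k (As i) (?M (q k As)) + (fdist k (?M (q k As)) (?M ?Q) + fdist k (?M ?Q) (mconj k W (As' i)))"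
            by (meson add_left_mono fdist_triangle order_trans)
          moreover have "fdist k (?M ?Q) (mconj k W (As' i)) \<le> sqrt (real k) * (2 * \<delta>)"
          proof -
            have "fdist k (?M ?Q) (mconj k W (As' i)) = fdist k (mconj k W (?M (q k As'))) (mconj k W (As' i))"
              by (simp add: meval_mconj[OF W(1)])
            also have "\<dots> \<le> fdist k (As' i) (?M (q k As'))"
              using fdist_mconj_le[OF W(1)] by (simp add: fdist_commute)
            also have "\<dots> \<le> sqrt (real k) * (2 * \<delta>)" by (rule close[OF As' i])
            finally show ?thesis .
          qed
          moreover have "fdist k (?M (q k As)) (?M ?Q) \<le> L * (real n * (sqrt (real k) * (2 * \<omega>')))"
          proof -
            have "fdist k (?M (q k As)) (?M ?Q)
                \<le> (\<Sum>w | P i w \<noteq> 0. cmod (P i w) * word_lip R' w) * (\<Sum>i<n. fdist k (q k As i) (?Q i))"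
              using P(1)[OF i] opb R0 by (intro fdist_meval_le) (auto simp: rat_ncpolys_iff)
            also have "\<dots> \<le> L * (real n * (sqrt (real k) * (2 * \<omega>')))"
            proof (rule mult_mono[OF _ S L0])
              show "(\<Sum>w | P i w \<noteq> 0. cmod (P i w) * word_lip R' w) \<le> L"
                unfolding L using i Li by (intro member_le_sum) auto
            qed (simp add: sum_nonneg)
            finally show ?thesis .
          qed
          ultimately have "fdist k (As i) (mconj k W (As' i))
              \<le> sqrt (real k) * (2 * \<delta>) + (L * (real n * (sqrt (real k) * (2 * \<omega>'))) + sqrt (real k) * (2 * \<delta>))"
            using close[OF As i] by linarith
          then show ?thesis by (simp add: algebra_simps)
        qed
        have "hs_dist k p As (\<lambda>i. mconj k W (As' i)) \<le> (\<Sum>i<p. fdist k (As i) (mconj k W (As' i))) / sqrt (real k)"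
          by (rule hs_dist_le_sum)
        also have "\<dots> \<le> (\<Sum>i<p. sqrt (real k) * (4 * \<delta> + L * (real n * (2 * \<omega>')))) / sqrt (real k)"
          using one by (intro divide_right_mono sum_mono) auto
        also have "\<dots> = real p * (4 * \<delta>) + 2 * (real p * real n * L) * \<omega>'"
        proof -
          have *: "(\<Sum>i<p. sqrt (real k) * c) / sqrt (real k) = real p * c" for c
            using k by simp
          show ?thesis unfolding * by (simp add: algebra_simps)
        qed
        also have "\<dots> < \<omega>"
        proof -
          \<comment> \<open>This factor of the denominator of \<open>\<omega>'\<close> is positive
            even if \<open>p\<close>, \<open>n\<close> or \<open>L\<close> is 0. The two terms
            become at most \<open>\<omega> / 2\<close> and \<open>\<omega> / 4\<close>, which leaves
            a strict inequality.\<close>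
          let ?D = "(real p + 1) * (real n + 1) * (L + 1)"
          have D: "?D > 0" using L0 by (intro mult_pos_pos) auto
          have "real p * real n * L \<le> ?D"
            using L0 by (intro mult_mono) auto
          then have "2 * (real p * real n * L) * \<omega>' \<le> 2 * ?D * \<omega>'"
            using \<omega>'0 by (intro mult_right_mono) auto
          also have "\<dots> = \<omega> / 4"
          proof -
            have *: "2 * d * (\<omega> / (8 * d)) = \<omega> / 4" if "d > 0" for d :: real using that by simp
            show ?thesis unfolding \<omega>' by (rule *[OF D])
          qed
          finally have "2 * (real p * real n * L) * \<omega>' \<le> \<omega> / 4" .
          moreover have "real p * (4 * \<delta>) \<le> \<omega> / 2"
            using \<delta> by (simp add: algebra_simps)
          ultimately show ?thesis using \<omega> by linarith
        qed
        finally show ?thesis .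
      qed
      with W(1) show ?thesis unfolding orbit_ball_iff by blast
    qed
    obtain C where "orbit_cover k n ?T \<omega>' C"
      using gamma_top_orbit_cover[OF \<omega>'0] by blast
    then show ?thesis
      by (rule o2_le_of_map[where q = "q k"]) (use qT ball in auto)
  qed
  moreover have "r \<ge> 1" by (simp add: r_def)
  ultimately show ?thesis using \<epsilon>(1) by blast
qed

text \<open>One radius \<open>R'\<close> and one scale \<open>\<omega>'\<close> serve every
  \<open>R\<close>, so each term of the supremum on the left is dominated by the same term on the
  right.\<close>

lemma Ktop_omega_le_Ktop_of_approx:
  fixes x y :: "nat \<Rightarrow> 'a"
  assumes y: "\<And>i. i < p \<Longrightarrow> st (y i) = y i"
    and x: "\<And>i. i < n \<Longrightarrow> st (x i) = x i"
    and gen: "\<And>i. i < n \<Longrightarrow> x i \<in> closure {a. \<exists>F. poly_rep p y F a}"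
    and P: "\<And>i. i < p \<Longrightarrow> P i \<in> rat_ncpolys n"
      "\<And>i. i < p \<Longrightarrow> norm (aeval sc (P i) x - y i) < \<delta>"
    and \<delta>: "0 < \<delta>" "8 * (real p + 1) * \<delta> \<le> \<omega>"
  shows "Ktop_omega sc p y \<omega> \<le> Ktop sc n x"
proof -
  define R' where "R' = (\<Sum>i<n. norm (x i)) + 2"
  define L where "L = (\<Sum>i<p. \<Sum>w | P i w \<noteq> 0. cmod (P i w) * word_lip R' w)"
  define \<omega>' where "\<omega>' = \<omega> / (8 * ((real p + 1) * (real n + 1) * (L + 1)))"
  have R': "R' > 0" unfolding R'_def by (intro add_nonneg_pos sum_nonneg) auto
  have "L \<ge> 0"
    unfolding L_def using R' by (intro sum_nonneg mult_nonneg_nonneg word_lip_nonneg) auto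
  moreover have "8 * (real p + 1) * \<delta> > 0" using \<delta>(1) by (intro mult_pos_pos) auto
  ultimately have \<omega>': "\<omega>' > 0"
    unfolding \<omega>'_def using \<delta>(2) by (intro divide_pos_pos mult_pos_pos) auto
  have "Ktop_omega sc p y \<omega> \<le> Ktop_omega sc n x \<omega>'"
    unfolding Ktop_omega_def
  proof (rule SUP_mono)
    fix R :: real
    show "\<exists>R'\<in>{0<..}. (INF er\<in>{0<..} \<times> {1..}. limsup (\<lambda>k. log_ratio (o2 k p (gamma_top sc p y R k (fst er) (snd er)) \<omega>) k))
        \<le> (INF er\<in>{0<..} \<times> {1..}. limsup (\<lambda>k. log_ratio (o2 k n (gamma_top sc n x R' k (fst er) (snd er)) \<omega>') k))"
    proof (intro bexI[of _ R'] INF_mono)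
      fix er :: "real \<times> nat" assume "er \<in> {0<..} \<times> {1..}"
      then have "fst er > 0" by auto
      from o2_gamma_top_le[OF y x gen P \<delta> R'_def L_def \<omega>'_def this]
      obtain \<epsilon> r where *: "\<epsilon> > 0" "r \<ge> 1"
        "\<And>k. o2 k p (gamma_top sc p y R k \<epsilon> r) \<omega> \<le> o2 k n (gamma_top sc n x R' k (fst er) (snd er)) \<omega>'"
        by blast
      then show "\<exists>er'\<in>{0<..} \<times> {1..}. limsup (\<lambda>k. log_ratio (o2 k p (gamma_top sc p y R k (fst er') (snd er')) \<omega>) k)
          \<le> limsup (\<lambda>k. log_ratio (o2 k n (gamma_top sc n x R' k (fst er) (snd er)) \<omega>') k)"
        by (intro bexI[of _ "(\<epsilon>, r)"] Limsup_mono always_eventually allI log_ratio_mono) auto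
    qed (simp add: R')
  qed
  also have "\<dots> \<le> Ktop sc n x" by (rule Ktop_omega_le_Ktop[OF \<omega>'])
  finally show ?thesis .
qed

end

section \<open>Approximation along the increasing sequence of subalgebras\<close>

theorem theorem3p3:
  fixes sc :: "complex \<Rightarrow> 'a::{real_normed_algebra_1,banach} \<Rightarrow> 'a"
    and st :: "'a \<Rightarrow> 'a"
    and p :: nat and y :: "nat \<Rightarrow> 'a"
    and Asub :: "nat \<Rightarrow> 'a set"
    and nn :: "nat \<Rightarrow> nat" and x :: "nat \<Rightarrow> nat \<Rightarrow> 'a"
  assumes "unital_cstar_algebra sc st"
    and "\<forall>i<p. st (y i) = y i"
    and "cstar_gen sc st (y ` {..<p}) = UNIV"
    and "\<forall>j. cstar_subalg sc st (Asub j)"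
    and "\<forall>j. Asub j \<subseteq> Asub (Suc j)"
    and "closure (\<Union>j. Asub j) = UNIV"
    and "\<forall>j. \<forall>i<nn j. st (x j i) = x j i"
    and "\<forall>j. cstar_gen sc st (x j ` {..<nn j}) = Asub j"
  shows "Ktop sc p y \<le> liminf (\<lambda>j. Ktop sc (nn j) (x j))"
proof -
  interpret cstar sc st by unfold_locales (rule assms(1))
  have gen: "a \<in> closure {a. \<exists>F. poly_rep p y F a}" for a
    using cstar_gen_subset_closure[of p y] assms(2,3) by auto
  have mono: "Asub i \<subseteq> Asub j" if "i \<le> j" for i j
    using assms(5)[rule_format] that by (rule lift_Suc_mono_le)
  have "Ktop_omega sc p y \<omega> \<le> liminf (\<lambda>j. Ktop sc (nn j) (x j))" if \<omega>: "\<omega> > 0" for \<omega>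
  proof (rule Liminf_bounded)
    define \<delta> where "\<delta> = \<omega> / (8 * (real p + 1))"
    have \<delta>: "0 < \<delta>" "8 * (real p + 1) * \<delta> \<le> \<omega>"
      using \<omega> by (simp_all add: \<delta>_def add_nonneg_pos)
    have "\<forall>i. \<exists>j. \<exists>a\<in>Asub j. dist a (y i) < \<delta>"
    proof
      fix i
      have "y i \<in> closure (\<Union>j. Asub j)" using assms(6) by simp
      then show "\<exists>j. \<exists>a\<in>Asub j. dist a (y i) < \<delta>"
        unfolding closure_approachable using \<delta>(1) by blast
    qed
    from choice[OF this] obtain J where J: "\<And>i. \<exists>a\<in>Asub (J i). dist a (y i) < \<delta>" by blast
    \<comment> \<open>The sum of the indices \<open>J i\<close> bounds each of them, so from there
      on \<open>Asub j\<close> contains approximants of all \<open>y i\<close> with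
      \<open>i < p\<close>.\<close>
    have "Ktop_omega sc p y \<omega> \<le> Ktop sc (nn j) (x j)" if j: "(\<Sum>i<p. J i) \<le> j" for j
    proof -
      have sub: "Asub j \<subseteq> closure {a. \<exists>F. poly_rep (nn j) (x j) F a}"
        using cstar_gen_subset_closure[of "nn j" "x j"] assms(7,8) by auto
      have "\<exists>q. q \<in> rat_ncpolys (nn j) \<and> norm (aeval sc q (x j) - y i) < \<delta>" if i: "i < p" for i
      proof -
        obtain a where a: "a \<in> Asub (J i)" "dist a (y i) < \<delta>" using J by blast
        have "J i \<le> (\<Sum>i<p. J i)" using i by (intro member_le_sum) auto
        then have "a \<in> closure {a. \<exists>F. poly_rep (nn j) (x j) F a}"
          using a(1) j mono[of "J i" j] sub by auto
        \<comment> \<open>Approximation happens twice, first in \<open>Asub (J i)\<close> and then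
          by polynomial values; the second tolerance is what the first leaves of
          \<open>\<delta>\<close>.\<close>
        moreover have "\<delta> - dist a (y i) > 0" using a(2) by simp
        ultimately obtain c F where c: "poly_rep (nn j) (x j) F c" "dist c a < \<delta> - dist a (y i)"
          unfolding closure_approachable by blast
        then obtain q where "q \<in> rat_ncpolys (nn j)" "aeval sc q (x j) = c"
          unfolding poly_rep_def by blast
        moreover have "dist c (y i) < \<delta>" using c(2) dist_triangle[of c "y i" a] by linarith
        ultimately show ?thesis by (auto simp: dist_norm)
      qed
      then have "\<forall>i\<in>{..<p}. \<exists>q. q \<in> rat_ncpolys (nn j) \<and> norm (aeval sc q (x j) - y i) < \<delta>" by blast
      from bchoice[OF this] obtain P where P: "\<And>i. i < p \<Longrightarrow> P i \<in> rat_ncpolys (nn j)"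
        "\<And>i. i < p \<Longrightarrow> norm (aeval sc (P i) (x j) - y i) < \<delta>" by blast
      show ?thesis
        by (rule Ktop_omega_le_Ktop_of_approx[OF _ _ gen P \<delta>]) (use assms(2,7) in auto)
    qed
    then show "eventually (\<lambda>j. Ktop_omega sc p y \<omega> \<le> Ktop sc (nn j) (x j)) sequentially"
      unfolding eventually_sequentially by blast
  qed
  \<comment> \<open>Near 0 from the right only positive scales occur, so the bound for each
    \<open>\<omega> > 0\<close> passes to the upper limit.\<close>
  then show ?thesis
    unfolding Ktop_def[of sc p y]
    by (intro Limsup_bounded eventually_at_right_less[of 0, THEN eventually_mono]) auto
qed

end
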